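(* Let $d\ge 2$ and let $\Pi$ be an arbitrary $\mathbf 0$-symmetric parallelepiped in $\mathbb R^d$, with pseudo-compound parallelepiped $\Pi^\ast$. Suppose that \[ \mu_1(\Pi^\ast,\mathbb Z^d)\le 1\quad\text{and}\quad \mu_1(\Pi,\mathbb Z^d)\ge 1. \] Then \[ \mu_k(\Pi,\mathbb Z^d)\le d^{\frac{1}{2(d-k)}},\qquad k=1,\ldots,d-1. \]
   Context: Successive minima: for a convex body $M\subset\mathbb R^d$ symmetric with respect to the origin and a $d$-dimensional (full rank) lattice $\Lambda\subset\mathbb R^d$, the $k$-th successive minimum $\mu_k(M,\Lambda)$ is the minimal positive $\mu$ such that $\mu M$ contains $k$ linearly independent points of $\Lambda$. Pseudo-compound parallelepiped: every $\mathbf 0$-symmetric (closed, non-degenerate) parallelepiped in $\mathbb R^d$ can be written as $\Pi=\{\mathbf z\in\mathbb R^d : |h_i(\mathbf z)|\le\eta_i,\ i=1,\ldots,d\}$ with positive numbers $\eta_1,\ldots,\eta_d$ and linear forms $h_1,\ldots,h_d$ on $\mathbb R^d$ whose coefficient matrix $H$ (rows are the forms) has $\det H=1$. Let $h_1^\ast,\ldots,h_d^\ast$ be the dual set of linear forms, i.e. $\langle h_i,h_j^\ast\rangle=\delta_{ij}$ where forms are identified with their coefficient vectors and $\langle\cdot,\cdot\rangle$ is the standard inner product. The pseudo-compound of $\Pi$ is \[ \Pi^\ast=\Big\{\mathbf z\in\mathbb R^d : |h_i^\ast(\mathbf z)|\le\frac1{\eta_i}\prod_{j=1}^d\eta_j,\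 i=1,\ldots,d\Big\}. \] *)

theory Defs
  imports "HOL-Analysis.Analysis"
begin

definition integer_lattice :: "(real ^ 'n) set" where
  "integer_lattice = {x. \<forall>i. x $ i \<in> \<int>}"

text \<open>
  For a compact \<open>M\<close> that is symmetric about, and a neighbourhood of, the origin, a full-rank
  lattice \<open>L\<close> and \<open>1 \<le> k \<le> d\<close>, the set below is nonempty and bounded below and its infimum is
  attained, so \<open>Inf\<close> is the minimum.  Linear independence is that of \<open>k\<close> distinct vectors:
  the set \<open>S\<close> has exactly \<open>k\<close> elements.
\<close>
definition successive_minimum :: "nat \<Rightarrow> (real ^ 'n) set \<Rightarrow> (real ^ 'n) set \<Rightarrow> real" where
  "successive_minimum k M L =
     Inf {\<mu>. \<mu> > 0 \<and> (\<exists>S. S \<subseteq> L \<inter> (\<lambda>x. \<mu> *\<^sub>R x) ` M \<and> independent S \<and> card S = k)}"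

definition symmetric_parallelepiped :: "(real ^ 'n) set \<Rightarrow> bool" where
  "symmetric_parallelepiped P \<longleftrightarrow>
     (\<exists>A :: real ^ 'n ^ 'n. invertible A \<and> P = (\<lambda>x. A *v x) ` {x. \<forall>i. \<bar>x $ i\<bar> \<le> 1})"

text \<open>Linear forms are identified with their coefficient vectors, the rows of \<open>H\<close>.\<close>
definition parallelepiped_of_forms :: "real ^ 'n ^ 'n \<Rightarrow> real ^ 'n \<Rightarrow> (real ^ 'n) set" where
  "parallelepiped_of_forms H \<eta> = {z. \<forall>i. \<bar>row i H \<bullet> z\<bar> \<le> \<eta> $ i}"

definition dual_forms :: "real ^ 'n ^ 'n \<Rightarrow> real ^ 'n ^ 'n \<Rightarrow> bool" where
  "dual_forms H H' \<longleftrightarrow> (\<forall>i j. row i H \<bullet> row j H' = (if i = j then 1 else 0))"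

text \<open>
  The presentation of \<open>P\<close> by forms is unique up to permuting the pairs \<open>(h\<^sub>i, \<eta>\<^sub>i)\<close> and
  rescaling them to \<open>(c\<^sub>i h\<^sub>i, \<bar>c\<^sub>i\<bar> \<eta>\<^sub>i)\<close> with \<open>\<bar>\<Prod>c\<^sub>i\<bar> = 1\<close>; none of this
  changes \<open>P'\<close>, so \<open>P'\<close> is determined by \<open>P\<close>.
\<close>
definition is_pseudo_compound :: "(real ^ 'n) set \<Rightarrow> (real ^ 'n) set \<Rightarrow> bool" where
  "is_pseudo_compound P P' \<longleftrightarrow>
     (\<exists>H H' \<eta>. (\<forall>i. \<eta> $ i > 0) \<and> det H = 1 \<and> dual_forms H H' \<and>
        P = parallelepiped_of_forms H \<eta> \<and>
        P' = parallelepiped_of_forms H' (\<chi> i. 1 / \<eta> $ i * (\<Prod>j\<in>UNIV. \<eta> $ j)))"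

lemma dual_forms_exists:
  fixes H :: "real ^ 'n ^ 'n"
  assumes "det H = 1"
  shows "\<exists>H'. dual_forms H H'"
proof -
  have "invertible H" using assms by (simp add: invertible_det_nz)
  then obtain B where B: "H ** B = mat 1" unfolding invertible_def by blast
  have "row i H \<bullet> row j (transpose B) = (H ** B) $ i $ j" for i j
    by (simp add: inner_vec_def row_def transpose_def matrix_matrix_mult_def)
  then have "dual_forms H (transpose B)"
    unfolding dual_forms_def B by (simp add: mat_def)
  then show ?thesis ..
qed

lemma symmetric_parallelepiped_imp_pseudo_compound:
  fixes P :: "(real ^ 'n) set"
  assumes "symmetric_parallelepiped P"
  shows "\<exists>P'. is_pseudo_compound P P'"
proof -
  obtain A :: "real ^ 'n ^ 'n" where "invertible A"
    and P: "P = (\<lambda>x. A *v x) ` {x. \<forall>i. \<bar>x $ i\<bar> \<le> 1}"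
    using assms unfolding symmetric_parallelepiped_def by blast
  then obtain B where AB: "A ** B = mat 1" and BA: "B ** A = mat 1"
    unfolding invertible_def by blast
  have "invertible B" using AB BA unfolding invertible_def by blast
  then have dB: "det B \<noteq> 0" by (simp add: invertible_det_nz)
  have P1: "P = {z. \<forall>i. \<bar>(B *v z) $ i\<bar> \<le> 1}"
  proof (intro set_eqI iffI)
    fix z assume "z \<in> P"
    then show "z \<in> {z. \<forall>i. \<bar>(B *v z) $ i\<bar> \<le> 1}"
      unfolding P by (auto simp: matrix_vector_mul_assoc BA)
  next
    fix z assume "z \<in> {z. \<forall>i. \<bar>(B *v z) $ i\<bar> \<le> 1}"
    moreover have "z = A *v (B *v z)" by (simp add: matrix_vector_mul_assoc AB)
    ultimately show "z \<in> P" unfolding P by blast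
  qed
  define k :: 'n where "k = undefined"
  define c where "c i = (if i = k then 1 / det B else 1)" for i
  define H where "H = (\<chi> i. c i *\<^sub>R row i B)"
  define \<eta> where "\<eta> = (\<chi> i. \<bar>c i\<bar>)"
  have c0: "c i \<noteq> 0" for i using dB by (simp add: c_def)
  have "H = (\<chi> i. if i = k then (1 / det B) *s row k B else row i B)"
    by (simp add: H_def c_def vec_eq_iff row_def)
  then have "det H = 1 / det B * det (\<chi> i. if i = k then row k B else row i B)"
    by (simp add: det_row_mul)
  also have "(\<chi> i. if i = k then row k B else row i B) = B"
    by (simp add: vec_eq_iff row_def)
  finally have detH: "det H = 1" using dB by simp
  have "(\<bar>row i H \<bullet> z\<bar> \<le> \<eta> $ i) = (\<bar>(B *v z) $ i\<bar> \<le> 1)" for i z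
  proof -
    have "row i H \<bullet> z = c i * (B *v z) $ i"
      by (simp add: H_def row_def inner_vec_def matrix_vector_mult_def sum_distrib_left mult.assoc)
    then show ?thesis using c0[of i] by (simp add: \<eta>_def abs_mult)
  qed
  then have P2: "P = parallelepiped_of_forms H \<eta>"
    unfolding P1 parallelepiped_of_forms_def by simp
  obtain H' where "dual_forms H H'" using dual_forms_exists detH by blast
  moreover have "\<forall>i. \<eta> $ i > 0" using c0 by (simp add: \<eta>_def)
  ultimately show ?thesis
    unfolding is_pseudo_compound_def using detH P2 by blast
qed

end

theory Submission
  imports Defs
begin

text \<open>
  Write \<open>d\<close> for the dimension, \<open>V = \<eta>\<^sub>1 \<cdots> \<eta>\<^sub>d\<close>, and \<open>K\<close> for the interior of \<open>P\<close>.
  Since \<open>\<mu>\<^sub>1(P') \<le> 1\<close>, there are non-zero integer vectors \<open>v \<in> \<mu> P'\<close> with \<open>\<mu>\<close> as close to \<open>1\<close> as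
  desired.  In the coordinates \<open>y\<^sub>i = \<langle>h\<^sub>i, z\<rangle> / \<eta>\<^sub>i\<close> the body \<open>K / 2\<close> is the cube \<open>(-1/2, 1/2)\<^sup>d\<close>, and
  \<open>\<langle>v, z\<rangle> = V \<langle>b, y\<rangle>\<close>, where membership of \<open>v\<close> in \<open>\<mu> P'\<close> says exactly that \<open>\<bar>b\<^sub>i\<bar> \<le> \<mu>\<close>, so that
  \<open>\<bar>b\<bar> \<le> \<mu> \<surd>d\<close>.  The slabs \<open>\<bar>\<langle>v, z\<rangle>\<bar> < t\<close> of \<open>K / 2\<close> are now measured in two ways.

  Geometry of numbers (lemma \<open>slab_measure_le\<close>): let \<open>1 \<le> \<lambda> < \<mu>\<^sub>k(P)\<close>.  The integer points of
  \<open>\<lambda> K\<close> orthogonal to \<open>v\<close> span a space \<open>L\<close> of dimension at most \<open>k - 1\<close>, while \<open>K\<close> itself has no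
  non-zero integer point because \<open>\<mu>\<^sub>1(P) \<ge> 1\<close>.  Stretch the slab by \<open>\<lambda>\<close> in the directions orthogonal to
  \<open>L\<close> and \<open>v\<close>, rescale it along \<open>v\<close> by \<open>1 / (2 t)\<close>, leave the directions of \<open>L\<close> alone, and translate each
  fibre over a point modulo \<open>L\<close> so that differences of image points remain in \<open>\<lambda> K\<close>.  This is the
  rearrangement in Minkowski's second theorem, with only two scales, applied to a slab instead of a
  hyperplane section.  The image is a packing under all integer translations, so its volume is at
  most \<open>1\<close>, and the slab has volume at most \<open>2 t / \<lambda>\<^bsup>d - k\<^esup>\<close>.

  Probability (lemma \<open>cube_slab_density_ge\<close>): for \<open>y\<close> uniform in the cube, \<open>\<langle>b, y\<rangle>\<close> has second
  moment \<open>\<bar>b\<bar>\<^sup>2 / 12\<close>.  A variable whose density around \<open>0\<close> is at most \<open>C\<close> on average over every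
  interval \<open>(-t, t)\<close> has second moment at least that of the uniform density of height \<open>C\<close>, namely
  \<open>1 / (12 C\<^sup>2)\<close>; this is Hensley's proof that central sections of the unit cube have volume at
  least one.  With \<open>C = 1 / \<lambda>\<^bsup>d - k\<^esup>\<close> this gives \<open>\<lambda>\<^bsup>d - k\<^esup> \<le> \<bar>b\<bar> \<le> \<mu> \<surd>d\<close>, which is lemma
  \<open>transference_inequality\<close>.  Letting \<open>\<mu>\<close> tend to \<open>1\<close> and \<open>\<lambda>\<close> to \<open>\<mu>\<^sub>k(P)\<close> yields the theorem.
\<close>

section \<open>Linear images and Lebesgue measure\<close>

text \<open>
  A shear is one row operation away from the identity matrix; this argument works for an index type
  without an order, where triangular form makes no sense.
\<close>
lemma det_matrix_shear:
  fixes m n :: "'n::finite"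
  assumes "m \<noteq> n"
  shows "det (matrix (\<lambda>x::real^'n. \<chi> i. if i = m then x $ m + x $ n else x $ i)) = 1"
proof -
  have "matrix (\<lambda>x::real^'n. \<chi> i. if i = m then x $ m + x $ n else x $ i)
      = (\<chi> k. if k = m then row m (mat 1) + 1 *s row n (mat 1) else row k (mat 1))"
    by (auto simp: matrix_def vec_eq_iff axis_def row_def mat_def)
  then show ?thesis
    using det_row_operation[OF assms, of "mat 1" 1] by simp
qed

lemma abs_det_matrix_swap:
  fixes m n :: "'n::finite"
  shows "\<bar>det (matrix (\<lambda>x::real^'n. \<chi> i. x $ Transposition.transpose m n i))\<bar> = 1"
proof -
  have "matrix (\<lambda>x::real^'n. \<chi> i. x $ Transposition.transpose m n i)
      = (\<chi> i. (mat 1 :: real^'n^'n) $ Transposition.transpose m n i)"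
    by (auto simp: matrix_def vec_eq_iff axis_def mat_def)
  then show ?thesis
    by (simp add: det_permute_rows permutes_swap_id sign_swap_id abs_mult)
qed

lemma content_swap_cbox:
  fixes m n :: "'n::finite" and a b :: "real^'n"
  defines "h \<equiv> (\<lambda>x::real^'n. \<chi> i. x $ Transposition.transpose m n i)"
  shows "measure lebesgue (h ` cbox a b) = measure lebesgue (cbox a b)"
proof (cases "cbox a b = {}")
  case False
  have hh: "h (h x) = x" for x by (simp add: h_def vec_eq_iff)
  have "h ` cbox a b = cbox (h a) (h b)"
  proof (intro set_eqI iffI)
    fix x assume "x \<in> cbox (h a) (h b)"
    then have "a $ i \<le> h x $ i \<and> h x $ i \<le> b $ i" for i
      by (simp add: mem_box_cart h_def)
         (metis transpose_involutory)
    then show "x \<in> h ` cbox a b"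
      by (metis hh image_eqI mem_box_cart)
  qed (auto simp: mem_box_cart h_def)
  moreover from this False have "cbox (h a) (h b) \<noteq> {}" by blast
  moreover have "(\<Prod>i\<in>UNIV. h b $ i - h a $ i) = (\<Prod>i\<in>UNIV. b $ i - a $ i)"
    using prod.permute[OF permutes_swap_id, where S=UNIV and g="\<lambda>i. b $ i - a $ i", of m n]
    by (simp add: h_def o_def)
  ultimately show ?thesis
    using False by (simp add: content_cbox_cart)
qed simp

text \<open>
  Translating the box so that its \<open>n\<close>-th side starts at \<open>0\<close> changes neither volume.
\<close>
lemma content_shear_cbox:
  fixes m n :: "'n::finite" and a b :: "real^'n"
  defines "h \<equiv> (\<lambda>x::real^'n. \<chi> i. if i = m then x $ m + x $ n else x $ i)"
  assumes mn: "m \<noteq> n"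
  shows "measure lebesgue (h ` cbox a b) = measure lebesgue (cbox a b)"
proof (cases "cbox a b = {}")
  case False
  define u :: "real^'n" where "u = (\<chi> i. if i = n then - a $ n else 0)"
  have lin: "linear h"
    by (rule linearI) (auto simp: h_def algebra_simps vec_eq_iff)
  have eq: "h ` cbox (u + a) (u + b) = (+) (h u) ` (h ` cbox a b)"
    unfolding cbox_translation image_comp o_def by (simp add: linear_add[OF lin])
  have "measure lebesgue (h ` cbox a b) = measure lebesgue (h ` cbox (u + a) (u + b))"
    by (simp add: eq measure_translation)
  also have "\<dots> = measure lebesgue (cbox (u + a) (u + b))"
  proof -
    have "cbox (u + a) (u + b) \<noteq> {}" using False by (simp add: cbox_translation)
    then show ?thesis
      unfolding h_def using mn
      by (intro measure_shear_interval) (auto simp: u_def)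
  qed
  also have "\<dots> = measure lebesgue (cbox a b)"
    by (simp add: cbox_translation measure_translation del: measure_completion)
  finally show ?thesis .
qed simp

text \<open>
  Every linear map is a composition of coordinate scalings, swaps, elementary shears and maps into
  a coordinate hyperplane, and both sides are multiplicative.
\<close>
lemma lmeasurable_linear_image_det:
  fixes f :: "real^'n \<Rightarrow> real^'n" and S :: "(real^'n) set"
  assumes f: "linear f" and S: "S \<in> lmeasurable"
  shows "f ` S \<in> lmeasurable \<and> measure lebesgue (f ` S) = \<bar>det (matrix f)\<bar> * measure lebesgue S"
proof -
  let ?P = "\<lambda>f :: real^'n \<Rightarrow> real^'n. \<forall>S\<in>lmeasurable. f ` S \<in> lmeasurable \<and>
              measure lebesgue (f ` S) = \<bar>det (matrix f)\<bar> * measure lebesgue S"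
  have unimodular: "?P h"
    if "linear h" "\<And>a b. measure lebesgue (h ` cbox a b) = measure lebesgue (cbox a b)"
      "\<bar>det (matrix h)\<bar> = 1" for h :: "real^'n \<Rightarrow> real^'n"
  proof
    fix S :: "(real^'n) set" assume S: "S \<in> lmeasurable"
    have "measure lebesgue (h ` cbox a b) = 1 * measure lebesgue (cbox a b)" for a b
      by (simp only: that(2) mult_1)
    from measure_linear_sufficient[OF that(1) S this]
    show "h ` S \<in> lmeasurable \<and> measure lebesgue (h ` S) = \<bar>det (matrix h)\<bar> * measure lebesgue S"
      unfolding that(3) by auto
  qed
  have "?P f"
  proof (rule induct_linear_elementary[OF f])
    fix f g :: "real^'n \<Rightarrow> real^'n"
    assume lin: "linear f" "linear g" and P: "?P f" "?P g"
    have "matrix (f \<circ> g) = matrix f ** matrix g"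
      using lin by (intro matrix_compose)
    then show "?P (f \<circ> g)"
      unfolding image_comp[symmetric] using P by (simp add: det_mul abs_mult)
  next
    fix f :: "real^'n \<Rightarrow> real^'n" and i
    assume lin: "linear f" and 0: "\<And>x. f x $ i = 0"
    have ninj: "\<not> inj f"
    proof
      assume "inj f"
      then have "surj f" using lin linear_injective_imp_surjective by blast
      then obtain x where "f x = axis i 1" by (metis surjE)
      with 0[of x] show False by simp
    qed
    then have "negligible (f ` S)" for S
      using lin by (intro negligible_linear_singular_image)
    moreover have "det (matrix f) = 0" using ninj det_nz_iff_inj[OF lin] by blast
    ultimately show "?P f"
      by (auto simp: negligible_iff_measure)
  next
    fix c :: "'n \<Rightarrow> real"
    have "matrix (\<lambda>x::real^'n. \<chi> i. c i * x $ i) = (\<chi> i j. if i = j then c i else 0)"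
      by (auto simp: matrix_def axis_def vec_eq_iff)
    then have "det (matrix (\<lambda>x::real^'n. \<chi> i. c i * x $ i)) = prod c UNIV"
      by (simp add: det_diagonal)
    then show "?P (\<lambda>x. \<chi> i. c i * x $ i)"
      unfolding \<open>det _ = _\<close> by (intro ballI conjI measurable_stretch measure_stretch)
  next
    fix m n :: 'n
    show "?P (\<lambda>x. \<chi> i. x $ Transposition.transpose m n i)"
      by (rule unimodular[OF _ content_swap_cbox abs_det_matrix_swap])
         (rule linearI; simp add: vec_eq_iff)
  next
    fix m n :: 'n
    assume mn: "m \<noteq> n"
    show "?P (\<lambda>x. \<chi> i. if i = m then x $ m + x $ n else x $ i)"
      by (rule unimodular[OF _ content_shear_cbox[OF mn]])
         (auto simp: det_matrix_shear[OF mn] vec_eq_iff algebra_simps intro!: linearI)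
  qed
  with S show ?thesis by blast
qed

text \<open>
  Conjugating by the orthogonal matrix with rows \<open>b i\<close> turns \<open>F\<close> into a diagonal matrix.
\<close>
lemma det_eigenbasis:
  fixes F :: "real^'n \<Rightarrow> real^'n"
  assumes lin: "linear F" and b: "\<And>i j::'n. b i \<bullet> b j = (if i = j then 1 else 0)"
    and eig: "\<And>i. F (b i) = c i *\<^sub>R b i"
  shows "det (matrix F) = (\<Prod>i\<in>UNIV. c i)"
proof -
  define Q :: "real^'n^'n" where "Q = (\<chi> i. b i)"
  have rO: "row i Q = b i" for i by (simp add: Q_def row_def)
  have "Q ** transpose Q = mat 1"
    using b by (auto simp: Q_def matrix_matrix_mult_def transpose_def mat_def inner_vec_def vec_eq_iff)
  then have dO: "det Q * det Q = 1"
    using det_mul[of Q "transpose Q"] by (simp add: det_transpose)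
  have "(matrix F ** transpose Q) = transpose Q ** (\<chi> i j. if i = j then c i else 0)"
  proof -
    have "(matrix F ** transpose Q) $ i $ j = (transpose Q ** (\<chi> i j. if i = j then c i else 0)) $ i $ j" for i j
    proof -
      have "(matrix F ** transpose Q) $ i $ j = (matrix F *v b j) $ i"
        by (simp add: matrix_matrix_mult_def matrix_vector_mult_def transpose_def Q_def)
      also have "\<dots> = c j * b j $ i" by (simp add: matrix_works lin eig)
      also have "\<dots> = (transpose Q ** (\<chi> i j. if i = j then c i else 0)) $ i $ j"
        by (simp add: matrix_matrix_mult_def transpose_def Q_def if_distrib cong: if_cong)
      finally show ?thesis .
    qed
    then show ?thesis by (simp add: vec_eq_iff)
  qed
  then have "det (matrix F) * det Q = det Q * det (\<chi> i j. if i = j then c i else 0)"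
    using det_mul[of "matrix F" "transpose Q"] det_mul[of "transpose Q"]
    by (simp only: det_transpose)
  also have "det (\<chi> i j. if i = j then c i else 0) = (\<Prod>i\<in>UNIV. c i)"
    by (simp add: det_diagonal)
  finally show ?thesis using dO by auto
qed

section \<open>Packings by integer translates\<close>

lemma emeasure_lebesgue_translation:
  fixes S :: "'a::euclidean_space set"
  shows "emeasure lebesgue ((+) a ` S) = emeasure lebesgue S"
  using emeasure_lebesgue_affine[of 1 a S] by (simp add: ac_simps cong: image_cong_simp)

text \<open>
  Cutting \<open>T\<close> along the half-open unit cells and moving all the pieces into one cell preserves
  volume, and the moved pieces stay disjoint because \<open>T\<close> is a packing.
\<close>
lemma blichfeldt:
  fixes T :: "(real^'n) set"
  assumes T: "T \<in> sets lebesgue"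
    and inj: "\<And>x y. x \<in> T \<Longrightarrow> y \<in> T \<Longrightarrow> x - y \<in> integer_lattice \<Longrightarrow> x = y"
  shows "emeasure lebesgue T \<le> 1"
proof -
  \<comment> \<open>\<open>g\<close> enumerates the lattice, \<open>C k\<close> is the half-open cell at \<open>g k\<close>,
    and \<open>R k\<close> is the piece of \<open>T\<close> in that cell, moved to the cell at the origin.\<close>
  define g :: "('n \<Rightarrow> int) \<Rightarrow> real^'n" where "g k = (\<chi> i. real_of_int (k i))" for k
  define C where "C k = {x::real^'n. \<forall>i. \<lfloor>x $ i\<rfloor> = k i}" for k
  define R where "R k = (+) (- g k) ` (T \<inter> C k)" for k
  have C_borel: "C k \<in> sets lebesgue" for k
  proof -
    have "C k = (\<Inter>i. {x. real_of_int (k i) \<le> x $ i} \<inter> {x. x $ i < real_of_int (k i) + 1})"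
      by (auto simp: C_def floor_eq_iff)
    also have "\<dots> \<in> sets borel"
      by (intro sets.countable_INT'' sets.Int borel_closed borel_open
          closed_Collect_le open_Collect_less continuous_intros) auto
    finally show ?thesis by (simp add: sets_completionI_sets)
  qed
  have disjC: "disjoint_family_on (\<lambda>k. T \<inter> C k) UNIV"
    unfolding disjoint_family_on_def C_def by force
  have T_eq: "T = (\<Union>k. T \<inter> C k)"
    unfolding C_def by (auto intro!: exI[of _ "\<lambda>i. \<lfloor>_ $ i\<rfloor>"])
  have gZ: "g k - g l \<in> integer_lattice" for k l
    by (simp add: g_def integer_lattice_def)
  have disjR: "disjoint_family_on R UNIV"
    unfolding disjoint_family_on_def
  proof (intro ballI impI equals0I)
    fix k l z assume kl: "k \<noteq> l" and "z \<in> R k \<inter> R l"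
    then obtain x y where x: "x \<in> T \<inter> C k" "z = - g k + x" and y: "y \<in> T \<inter> C l" "z = - g l + y"
      by (auto simp: R_def)
    have "x - y = g k - g l" using x(2) y(2) by (simp add: algebra_simps)
    with gZ x y have "x = y" by (metis Int_iff inj)
    with x y kl show False using disjC unfolding disjoint_family_on_def by blast
  qed
  have R_sets: "R k \<in> sets lebesgue" for k
    unfolding R_def by (intro lebesgue_sets_translation sets.Int T C_borel)
  have "emeasure lebesgue T = (\<integral>\<^sup>+k. emeasure lebesgue (T \<inter> C k) \<partial>count_space UNIV)"
    by (subst T_eq, rule emeasure_UN_countable) (use T C_borel disjC in auto)
  also have "\<dots> = (\<integral>\<^sup>+k. emeasure lebesgue (R k) \<partial>count_space UNIV)"
    by (simp only: R_def emeasure_lebesgue_translation)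
  also have "\<dots> = emeasure lebesgue (\<Union>k. R k)"
    by (rule emeasure_UN_countable[symmetric]) (use R_sets disjR in auto)
  also have "\<dots> \<le> emeasure lebesgue (cbox 0 (\<chi> i. 1) :: (real^'n) set)"
  proof (rule emeasure_mono)
    show "(\<Union>k. R k) \<subseteq> cbox 0 (\<chi> i. 1)"
      by (auto simp: R_def C_def g_def mem_box_cart floor_eq_iff)
         (metis add.commute diff_le_eq less_imp_le)
  qed simp
  also have "\<dots> = 1"
  proof -
    have "cbox 0 (\<chi> i. 1) \<noteq> ({} :: (real^'n) set)" by (simp add: interval_ne_empty_cart)
    then have "measure lebesgue (cbox 0 (\<chi> i. 1) :: (real^'n) set) = 1"
      by (simp add: content_cbox_cart)
    then show ?thesis by (simp add: emeasure_eq_measure2 lmeasurable_cbox del: measure_completion)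
  qed
  finally show ?thesis .
qed

section \<open>Orthonormal bases adapted to a subspace and a normal vector\<close>

text \<open>
  Gram-Schmidt applied to an orthonormal basis of \<open>S\<close> together with the normalised \<open>v\<close>.
\<close>
lemma adapted_orthonormal_basis:
  fixes S :: "(real^'n) set" and v :: "real^'n"
  assumes S: "subspace S" and v: "v \<noteq> 0" and vS: "\<And>x. x \<in> S \<Longrightarrow> v \<bullet> x = 0"
  obtains b :: "'n \<Rightarrow> real^'n" and I i0
  where "\<And>i j. b i \<bullet> b j = (if i = j then 1 else 0)"
    "card I = dim S" "i0 \<notin> I" "b i0 = v /\<^sub>R norm v"
    "\<And>x i. x \<in> S \<Longrightarrow> i \<notin> I \<Longrightarrow> b i \<bullet> x = 0"
proof -
  obtain B where B: "B \<subseteq> S" "pairwise orthogonal B" "\<And>x. x \<in> B \<Longrightarrow> norm x = 1"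
      "independent B" "card B = dim S" "span B = S"
    using orthonormal_basis_subspace[OF S] by metis
  define u where "u = v /\<^sub>R norm v"
  have u: "norm u = 1" "u \<notin> S" using v vS[of u] by (auto simp: u_def)
  have uS: "x \<in> S \<Longrightarrow> u \<bullet> x = 0" for x using vS by (simp add: u_def)
  have "pairwise orthogonal (insert u B)"
    using B(1,2) uS by (auto simp: pairwise_insert orthogonal_def inner_commute)
  then obtain U where U: "U \<inter> insert 0 (insert u B) = {}" "pairwise orthogonal (insert u B \<union> U)"
      "span (insert u B \<union> U) = span (insert u B \<union> UNIV)"
    using orthogonal_extension_strong[of "insert u B" UNIV] by blast
  define E where "E = insert u B \<union> U"
  define D where "D = (\<lambda>x. x /\<^sub>R norm x) ` E"
  have D_orth: "pairwise orthogonal D"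
    unfolding pairwise_def
  proof (intro ballI impI)
    fix x y assume "x \<in> D" "y \<in> D" "x \<noteq> y"
    then obtain x0 y0 where *: "x0 \<in> E" "y0 \<in> E" "x = x0 /\<^sub>R norm x0" "y = y0 /\<^sub>R norm y0"
      by (auto simp: D_def)
    with \<open>x \<noteq> y\<close> have "orthogonal x0 y0"
      using U(2) by (metis E_def pairwiseD)
    then show "orthogonal x y" by (simp add: * orthogonal_clauses)
  qed
  have E0: "0 \<notin> E" using U(1) u(1) B(3)[of 0] by (auto simp: E_def)
  have D_norm: "x \<in> D \<Longrightarrow> norm x = 1" for x
  proof -
    assume "x \<in> D"
    then obtain y where "y \<in> E" "x = y /\<^sub>R norm y" by (auto simp: D_def)
    with E0 show ?thesis by (cases "y = 0") auto
  qed
  have D_ind: "independent D"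
    using D_orth by (rule pairwise_orthogonal_independent) (use D_norm in force)
  have "E \<subseteq> span D"
  proof
    fix x assume x: "x \<in> E"
    then have "norm x *\<^sub>R (x /\<^sub>R norm x) \<in> span D"
      by (intro span_mul span_base) (auto simp: D_def)
    moreover have "x \<noteq> 0" using x E0 by metis
    ultimately show "x \<in> span D" by simp
  qed
  then have "span E \<subseteq> span D"
    by (simp add: span_minimal)
  then have "span D = UNIV" using U(3) by (auto simp: E_def)
  then have "card D = CARD('n)"
    using dim_eq_card[OF _ D_ind, of UNIV] by simp
  moreover have "finite D" using D_ind by (rule independent_imp_finite)
  ultimately obtain b where b: "bij_betw b (UNIV::'n set) D"
    using finite_same_card_bij[of "UNIV::'n set" D] by auto
  have unit_D: "x \<in> D" if "x \<in> E" "norm x = 1" for x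
    using that by (force simp: D_def)
  have BD: "B \<subseteq> D" "u \<in> D" "u \<notin> B"
    using u B(1,3) unit_D by (auto simp: E_def)
  define I where "I = b -` B"
  have "b ` I = B"
    using b BD(1) by (auto simp: I_def bij_betw_def)
  then have cI: "card I = dim S"
    using b B(5) card_image[of b I] by (auto simp: bij_betw_def inj_on_def)
  obtain i0 where i0: "b i0 = u" using b BD(2) by (auto simp: bij_betw_def)
  have ortho: "b i \<bullet> b j = (if i = j then 1 else 0)" for i j
  proof (cases "i = j")
    case True
    then show ?thesis using D_norm[of "b i"] b by (auto simp: bij_betw_def norm_eq_1)
  next
    case False
    then have "b i \<noteq> b j" "b i \<in> D" "b j \<in> D" using b by (auto simp: bij_betw_def inj_def)
    then show ?thesis using D_orth False by (auto simp: pairwise_def orthogonal_def)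
  qed
  have vanish: "b i \<bullet> x = 0" if "x \<in> S" "i \<notin> I" for x i
  proof -
    have "b i \<bullet> y = 0" if yB: "y \<in> B" for y
    proof -
      obtain j where "b j = y" "j \<in> I" using \<open>b ` I = B\<close> yB by blast
      then show ?thesis using ortho[of i j] \<open>i \<notin> I\<close> by (auto split: if_splits)
    qed
    then have "span B \<subseteq> {x. b i \<bullet> x = 0}"
      by (intro span_minimal subspace_hyperplane) auto
    then show ?thesis using that B(6) by auto
  qed
  have "i0 \<notin> I" using i0 BD(3) by (simp add: I_def)
  from ortho cI this i0 vanish show thesis
    unfolding u_def by (rule that)
qed

lemma orthonormal_family_eqI:
  fixes b :: "'n \<Rightarrow> real^'n"
  assumes b: "\<And>i j. b i \<bullet> b j = (if i = j then 1 else 0)"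
    and xy: "\<And>i. b i \<bullet> x = b i \<bullet> y"
  shows "x = y"
proof -
  define Q :: "real^'n^'n" where "Q = (\<chi> i. b i)"
  have "Q ** transpose Q = mat 1"
    using b by (auto simp: Q_def matrix_matrix_mult_def transpose_def mat_def inner_vec_def vec_eq_iff)
  then have inv: "transpose Q ** Q = mat 1" by (simp add: matrix_left_right_inverse)
  have "Q *v x = Q *v y"
    using xy by (simp add: vec_eq_iff Q_def matrix_vector_mult_def inner_vec_def)
  then have "(transpose Q ** Q) *v x = (transpose Q ** Q) *v y"
    by (simp add: matrix_vector_mul_assoc[symmetric])
  then show ?thesis by (simp add: inv)
qed

section \<open>Volume of slabs of an admissible body\<close>

text \<open>
  This is how symmetry enters the packing argument: points of \<open>K / 2\<close> differ by points of \<open>K\<close>, also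
  when they lie in a section of \<open>K / 2\<close> that avoids the origin.
\<close>
lemma convex_symmetric_diff_mem:
  assumes "convex K" "\<And>x. x \<in> K \<Longrightarrow> - x \<in> K" "2 *\<^sub>R x \<in> K" "2 *\<^sub>R y \<in> K"
  shows "x - y \<in> (K :: 'a::real_vector set)"
proof -
  have "(1/2) *\<^sub>R (2 *\<^sub>R x) + (1/2) *\<^sub>R (- (2 *\<^sub>R y)) \<in> K"
    using assms by (intro convexD) auto
  then show ?thesis by simp
qed

text \<open>
  For a point \<open>x\<close> of the slab choose \<open>c(x) \<in> K / 2\<close> congruent to \<open>x\<close> modulo the span \<open>L\<close> of \<open>Z\<close>, depending
  only on the class of \<open>x\<close> modulo \<open>L\<close>.  The map \<open>x \<mapsto> x + (lam - 1) c(x)\<close> multiplies volumes by the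
  power of \<open>lam\<close> given by the codimension of \<open>L\<close>; replacing its factor \<open>lam\<close> in the direction of \<open>v\<close>
  by \<open>\<beta> = 1 / (2 t)\<close> makes the image so thin that an integral difference \<open>z\<close> of image points satisfies
  \<open>\<bar>v \<bullet> z\<bar> < 1\<close>, hence \<open>v \<bullet> z = 0\<close>.  Then \<open>z\<close> is \<open>lam\<close> times a convex combination of \<open>x - y\<close> and
  \<open>c(x) - c(y)\<close>, so it lies in \<open>lam K\<close> and therefore in \<open>L\<close>; this forces \<open>x\<close> and \<open>y\<close> into the same class,
  so \<open>z = x - y \<in> K\<close>, and \<open>z = 0\<close>.  Thus the image is a packing, and its volume is at most \<open>1\<close>.
\<close>
lemma slab_measure_le:
  fixes K :: "(real^'n) set" and v :: "real^'n"
  assumes K: "open K" "bounded K" "convex K" and sym: "\<And>x. x \<in> K \<Longrightarrow> - x \<in> K"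
    and v: "v \<in> integer_lattice" "v \<noteq> 0"
    and lam: "1 \<le> lam" and t: "0 < t"
    and adm: "\<And>z. z \<in> K \<Longrightarrow> z \<in> integer_lattice \<Longrightarrow> z = 0"
    and dimL: "dim {z \<in> integer_lattice. v \<bullet> z = 0 \<and> z /\<^sub>R lam \<in> K} \<le> m"
  shows "measure lebesgue {x. 2 *\<^sub>R x \<in> K \<and> \<bar>v \<bullet> x\<bar> < t} \<le> 2 * t / lam ^ (CARD('n) - 1 - m)"
proof -
  define Z where "Z = {z \<in> integer_lattice. v \<bullet> z = 0 \<and> z /\<^sub>R lam \<in> K}"
  have "v \<bullet> x = 0" if "x \<in> span Z" for x
  proof -
    have "span Z \<subseteq> {x. v \<bullet> x = 0}"
      by (intro span_minimal subspace_hyperplane) (auto simp: Z_def)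
    with that show ?thesis by auto
  qed
  then obtain b :: "'n \<Rightarrow> real^'n" and I i0
    where b: "\<And>i j. b i \<bullet> b j = (if i = j then 1 else 0)"
    and cI: "card I = dim (span Z)" and i0: "i0 \<notin> I" "b i0 = v /\<^sub>R norm v"
    and bL: "\<And>x i. x \<in> span Z \<Longrightarrow> i \<notin> I \<Longrightarrow> b i \<bullet> x = 0"
    using adapted_orthonormal_basis[OF subspace_span[of Z] v(2)] by metis
  define \<beta> where "\<beta> = 1 / (2 * t)"
  define Q where "Q = {x. 2 *\<^sub>R x \<in> K}"
  define Qt where "Qt = Q \<inter> {x. \<bar>v \<bullet> x\<bar> < t}"
  \<comment> \<open>\<open>q\<close> projects orthogonally onto \<open>span Z\<close>, \<open>p\<close> along it; \<open>F\<close> is the linear part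
    of the rearrangement and is diagonal in the basis \<open>b\<close> with eigenvalues \<open>c\<close>.\<close>
  define q where "q x = (\<Sum>i\<in>I. (b i \<bullet> x) *\<^sub>R b i)" for x
  define p where "p x = x - q x" for x
  define F where "F x = x + (lam - 1) *\<^sub>R p x + ((\<beta> - lam) * (b i0 \<bullet> x)) *\<^sub>R b i0" for x
  define c where "c i = (if i \<in> I then 1 else if i = i0 then \<beta> else lam)" for i
  have \<beta>: "\<beta> > 0" using t by (simp add: \<beta>_def)
  have v_b: "v = norm v *\<^sub>R b i0" using v(2) i0(2) by simp
  have b_q: "b i \<bullet> q x = (if i \<in> I then b i \<bullet> x else 0)" for i x
    by (simp add: q_def inner_sum_right b if_distrib[where f="\<lambda>u. _ * u"] cong: if_cong)
  have b_p: "b i \<bullet> p x = (if i \<in> I then 0 else b i \<bullet> x)" for i x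
    by (simp add: p_def inner_diff_right b_q)
  have b_F: "b i \<bullet> F x = c i * (b i \<bullet> x)" for i x
    using i0(1) by (auto simp: F_def c_def inner_add_right b_p b algebra_simps)
  have lin_q: "linear q"
    unfolding q_def by (intro linear_compose_sum ballI) (auto intro!: linearI simp: inner_add_right algebra_simps)
  have lin_p: "linear p"
    unfolding p_def by (intro linear_compose_sub lin_q linear_id[unfolded id_def])
  have lin_F: "linear F"
    unfolding F_def using lin_p
    by (intro linearI) (simp_all add: linear_add linear_cmul inner_add_right algebra_simps)
  have F_b: "F (b j) = c j *\<^sub>R b j" for j
    by (rule orthonormal_family_eqI[OF b]) (simp add: b_F b)
  have det_F: "det (matrix F) = \<beta> * lam ^ (CARD('n) - 1 - card I)"
  proof -
    have "det (matrix F) = (\<Prod>i\<in>UNIV. c i)"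
      by (rule det_eigenbasis[OF lin_F b F_b])
    also have "\<dots> = (\<Prod>i\<in>- I. c i)"
      by (rule prod.mono_neutral_right) (auto simp: c_def)
    also have "\<dots> = c i0 * (\<Prod>i\<in>- I - {i0}. c i)"
      using i0(1) by (intro prod.remove) auto
    also have "\<dots> = \<beta> * (\<Prod>i\<in>- I - {i0}. lam)"
      using i0(1) by (auto simp: c_def intro!: prod.cong)
    also have "\<dots> = \<beta> * lam ^ (CARD('n) - 1 - card I)"
      using i0(1) by (simp add: Compl_eq_Diff_UNIV card_Diff_subset)
    finally show ?thesis .
  qed
  have cont: "continuous_on UNIV q" "continuous_on UNIV p"
    using lin_q lin_p by (simp_all add: linear_continuous_on linear_linear)
  have Q_open: "open Q"
    unfolding Q_def
    by (rule open_vimage[OF K(1), of "\<lambda>x. 2 *\<^sub>R x", unfolded vimage_def])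
       (intro continuous_intros)
  have Qt_open: "open Qt"
    unfolding Qt_def by (intro open_Int Q_open open_Collect_less continuous_intros)
  have Q_diff: "x - y \<in> K" if "x \<in> Q" "y \<in> Q" for x y
    using convex_symmetric_diff_mem[OF K(3) sym] that by (auto simp: Q_def)
  have "bounded Qt"
  proof -
    have "Qt \<subseteq> (\<lambda>x. (1/2) *\<^sub>R x) ` K"
      by (auto simp: Qt_def Q_def intro!: image_eqI[of _ _ "2 *\<^sub>R _"])
    then show ?thesis using bounded_scaling[OF K(2)] bounded_subset by blast
  qed
  then have Qt_meas: "Qt \<in> lmeasurable"
    using Qt_open by (simp add: lmeasurable_open)
  \<comment> \<open>The representative of a class is taken from a countable dense set, as the first one that
    lies in \<open>Q\<close>.  This makes the rearrangement piecewise affine on countably many Borel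
    pieces \<open>U n\<close>.\<close>
  obtain D :: "(real^'n) set" where D: "countable D" "\<And>X. open X \<Longrightarrow> X \<noteq> {} \<Longrightarrow> \<exists>d\<in>D. d \<in> X"
    using countable_dense_setE by blast
  have D_ne: "D \<noteq> {}" using D(2)[of UNIV] by auto
  define d where "d = from_nat_into D"
  define A where "A n = {x. p x + q (d n) \<in> Q}" for n
  define N where "N x = (LEAST n. x \<in> A n)" for x
  have ex_A: "\<exists>n. x \<in> A n" if "x \<in> Q" for x
  proof -
    have "open ((\<lambda>y. p x + q y) -` Q)"
      by (intro open_vimage Q_open continuous_intros cont)
    moreover have "x \<in> (\<lambda>y. p x + q y) -` Q" using that by (simp add: p_def)
    ultimately obtain y where "y \<in> D" "p x + q y \<in> Q" using D(2) by blast
    then show ?thesis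
      unfolding A_def d_def using from_nat_into_surj[OF D(1)] by force
  qed
  have N_A: "x \<in> A (N x)" if "x \<in> Q" for x
    unfolding N_def using ex_A[OF that] by (rule LeastI_ex)
  have A_open: "open (A n)" for n
    unfolding A_def
    by (rule open_vimage[OF Q_open, of "\<lambda>x. p x + q (d n)", unfolded vimage_def])
       (intro continuous_intros cont)
  define U where "U n = {x \<in> Qt. N x = n}" for n
  have U_eq: "U n = Qt \<inter> A n - (\<Union>k<n. A k)" for n
  proof (intro set_eqI iffI)
    fix x assume "x \<in> U n"
    then have x: "x \<in> Qt" "N x = n" "x \<in> Q" by (auto simp: U_def Qt_def)
    have "x \<notin> A k" if "k < n" for k
      using that x(2) not_less_Least unfolding N_def by metis
    moreover have "x \<in> A n" using N_A[OF x(3)] x(2) by simp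
    ultimately show "x \<in> Qt \<inter> A n - (\<Union>k<n. A k)" using x(1) by blast
  next
    fix x assume x: "x \<in> Qt \<inter> A n - (\<Union>k<n. A k)"
    have "N x = n"
      unfolding N_def
    proof (rule Least_equality)
      show "n \<le> k" if "x \<in> A k" for k using that x by (meson DiffD2 UN_I lessThan_iff not_less)
    qed (use x in blast)
    with x show "x \<in> U n" by (simp add: U_def)
  qed
  have U_meas: "U n \<in> lmeasurable" for n
  proof (rule fmeasurableI2[OF Qt_meas])
    have "U n \<in> sets borel"
      unfolding U_eq using Qt_open A_open by (intro sets.Diff sets.Int sets.finite_UN) auto
    then show "U n \<in> sets lebesgue" by (simp add: sets_completionI_sets)
  qed (auto simp: U_def)
  have U_UN: "(\<Union>n. U n) = Qt" by (auto simp: U_def)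
  \<comment> \<open>On \<open>U n\<close> the class representative is \<open>p x + q (d n)\<close>, and \<open>F\<close> already contains
    the part \<open>(lam - 1) p x\<close> of its multiple.\<close>
  define f where "f n x = F x + (lam - 1) *\<^sub>R q (d n)" for n x
  have key: "x = y" if x: "x \<in> U n" and y: "y \<in> U k" and Z: "f n x - f k y \<in> integer_lattice"
    for x y n k
  proof -
    define z where "z = f n x - f k y"
    have xQ: "x \<in> Q" "y \<in> Q" and xt: "\<bar>v \<bullet> x\<bar> < t" "\<bar>v \<bullet> y\<bar> < t" and Nn: "N x = n" "N y = k"
      using x y by (auto simp: U_def Qt_def)
    have b_z: "b i \<bullet> z = c i * (b i \<bullet> (x - y)) + (lam - 1) * (if i \<in> I then b i \<bullet> (d n - d k) else 0)" for i
      by (auto simp: z_def f_def inner_add_right inner_diff_right b_F b_q algebra_simps)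
    have "v \<bullet> z = \<beta> * (v \<bullet> x - v \<bullet> y)"
    proof -
      have "b i0 \<bullet> z = \<beta> * (b i0 \<bullet> (x - y))" using i0(1) by (simp add: b_z c_def)
      then have "norm v * (b i0 \<bullet> z) = \<beta> * (norm v * (b i0 \<bullet> (x - y)))" by simp
      then show ?thesis
        using v_b by (metis inner_diff_right inner_scaleR_left)
    qed
    also have "\<bar>\<dots>\<bar> < \<beta> * (2 * t)"
      using \<beta> xt by (simp add: abs_mult)
    also have "\<beta> * (2 * t) = 1" using t by (simp add: \<beta>_def)
    finally have "\<bar>v \<bullet> z\<bar> < 1" by simp
    moreover have "v \<bullet> z \<in> \<int>"
      using v(1) Z unfolding inner_vec_def z_def
      by (auto simp: integer_lattice_def intro!: Ints_sum Ints_mult)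
    ultimately have vz: "v \<bullet> z = 0" by (metis Ints_nonzero_abs_less1)
    then have "v \<bullet> x = v \<bullet> y" using \<open>v \<bullet> z = \<beta> * (v \<bullet> x - v \<bullet> y)\<close> \<beta> by simp
    then have i0xy: "b i0 \<bullet> (x - y) = 0" using i0(2) by (simp add: inner_diff_right)
    \<comment> \<open>The \<open>v\<close>-components of \<open>x\<close> and \<open>y\<close> agree from here on, so the exceptional
      factor \<open>\<beta>\<close> disappears and the difference takes the form of the unmodified rearrangement.\<close>
    define cx cy where "cx = p x + q (d n)" and "cy = p y + q (d k)"
    have cQ: "cx \<in> Q" "cy \<in> Q"
      using N_A[OF xQ(1)] N_A[OF xQ(2)] by (auto simp: cx_def cy_def Nn A_def)
    have z_eq: "z = (x - y) + (lam - 1) *\<^sub>R (cx - cy)"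
    proof (rule orthonormal_family_eqI[OF b])
      fix i
      show "b i \<bullet> z = b i \<bullet> ((x - y) + (lam - 1) *\<^sub>R (cx - cy))"
        using i0xy by (auto simp: b_z cx_def cy_def c_def inner_add_right inner_diff_right b_p b_q algebra_simps)
    qed
    have "(1 / lam) *\<^sub>R (x - y) + ((lam - 1) / lam) *\<^sub>R (cx - cy) \<in> K"
      using lam by (intro convexD[OF K(3)] Q_diff xQ cQ) (auto simp: field_simps)
    also have "(1 / lam) *\<^sub>R (x - y) + ((lam - 1) / lam) *\<^sub>R (cx - cy) = z /\<^sub>R lam"
      using lam by (simp add: z_eq algebra_simps divide_inverse)
    finally have "z \<in> span Z"
      using vz Z by (auto simp: Z_def z_def intro!: span_base)
    have pxy: "p x = p y"
    proof (rule orthonormal_family_eqI[OF b])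
      fix i
      show "b i \<bullet> p x = b i \<bullet> p y"
      proof (cases "i \<in> I \<or> i = i0")
        case True
        then show ?thesis using i0xy by (auto simp: b_p inner_diff_right)
      next
        case False
        then have "lam * (b i \<bullet> (x - y)) = 0"
          using bL[OF \<open>z \<in> span Z\<close>, of i] by (simp add: b_z c_def)
        with lam show ?thesis by (simp add: b_p inner_diff_right)
      qed
    qed
    then have "N x = N y" by (simp add: N_def A_def)
    then have "cx = cy" using pxy Nn by (simp add: cx_def cy_def)
    then have "z = x - y" by (simp add: z_eq)
    moreover from this have "z = 0" using Q_diff[OF xQ] Z by (intro adm) (auto simp: z_def)
    ultimately show "x = y" by simp
  qed
  have f_image: "f n ` X = (+) ((lam - 1) *\<^sub>R q (d n)) ` (F ` X)" for n X
    by (auto simp: f_def image_image add.commute)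
  have fU: "f n ` U n \<in> lmeasurable"
       "measure lebesgue (f n ` U n) = \<bar>det (matrix F)\<bar> * measure lebesgue (U n)" for n
    using lmeasurable_linear_image_det[OF lin_F U_meas[of n]]
    by (simp_all only: f_image measurable_translation measure_translation)
  have zero_lat: "(0::real^'n) \<in> integer_lattice" by (simp add: integer_lattice_def)
  have disj: "disjoint_family (\<lambda>n. f n ` U n)"
    unfolding disjoint_family_on_def
  proof (intro ballI impI equals0I)
    fix n k z assume "n \<noteq> k" "z \<in> f n ` U n \<inter> f k ` U k"
    then obtain x y where "x \<in> U n" "y \<in> U k" "f n x = f k y" by force
    with key[of x n y k] zero_lat \<open>n \<noteq> k\<close> show False by (auto simp: U_def)
  qed
  have disjU: "disjoint_family U" by (auto simp: disjoint_family_on_def U_def)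
  \<comment> \<open>Every piece is scaled by the same determinant, so the volume of the packing is
    \<open>\<delta>\<close> times that of the slab.\<close>
  define \<delta> where "\<delta> = \<bar>det (matrix F)\<bar>"
  have "ennreal (\<delta> * measure lebesgue Qt) = ennreal \<delta> * emeasure lebesgue Qt"
    using Qt_meas by (simp add: \<delta>_def ennreal_mult emeasure_eq_measure2)
  also have "\<dots> = ennreal \<delta> * (\<Sum>n. emeasure lebesgue (U n))"
    using U_meas disjU by (subst suminf_emeasure) (auto simp: U_UN)
  also have "\<dots> = (\<Sum>n. ennreal \<delta> * emeasure lebesgue (U n))"
    by simp
  also have "\<dots> = (\<Sum>n. emeasure lebesgue (f n ` U n))"
    using U_meas fU by (simp add: \<delta>_def ennreal_mult emeasure_eq_measure2)
  also have "\<dots> = emeasure lebesgue (\<Union>n. f n ` U n)"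
    using fU(1) disj by (intro suminf_emeasure) auto
  also have "\<dots> \<le> 1"
  proof (rule blichfeldt)
    show "(\<Union>n. f n ` U n) \<in> sets lebesgue" using fU(1) by auto
    fix x y assume "x \<in> (\<Union>n. f n ` U n)" "y \<in> (\<Union>n. f n ` U n)" "x - y \<in> integer_lattice"
    then obtain n k x' y' where *: "x' \<in> U n" "x = f n x'" "y' \<in> U k" "y = f k y'"
      "f n x' - f k y' \<in> integer_lattice" by auto
    then have "x' = y'" by (intro key)
    with * show "x = y" by (auto simp: U_def)
  qed
  finally have le1: "\<delta> * measure lebesgue Qt \<le> 1" by simp
  have "lam ^ (CARD('n) - 1 - m) \<le> lam ^ (CARD('n) - 1 - card I)"
    using lam dimL cI by (intro power_increasing) (auto simp: Z_def)
  then have "\<beta> * lam ^ (CARD('n) - 1 - m) \<le> \<delta>"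
    using \<beta> lam by (simp add: \<delta>_def det_F abs_mult)
  then have "\<beta> * lam ^ (CARD('n) - 1 - m) * measure lebesgue Qt \<le> 1"
    using le1 by (meson measure_nonneg mult_right_mono order_trans)
  then have "measure lebesgue Qt * lam ^ (CARD('n) - 1 - m) \<le> 2 * t"
    using t by (simp add: \<beta>_def field_simps)
  moreover have "Qt = {x. 2 *\<^sub>R x \<in> K \<and> \<bar>v \<bullet> x\<bar> < t}" by (auto simp: Qt_def Q_def)
  ultimately show ?thesis using lam by (simp add: pos_le_divide_eq)
qed

section \<open>Second moments and truncated squares\<close>

text \<open>
  The truncated square is the integral of \<open>2 t\<close> over the \<open>t \<le> M\<close> exceeding \<open>\<bar>u\<bar>\<close>.  Written in this way it
  can be integrated over \<open>u\<close> by Tonelli's theorem, which yields the layer-cake formula below.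
\<close>
lemma nn_integral_truncated_square:
  fixes u M :: real
  assumes "0 \<le> M"
  shows "(\<integral>\<^sup>+t. ennreal (2 * t) * indicator {0..M} t * indicator {\<bar>u\<bar><..} t \<partial>lborel) = ennreal (max 0 (M\<^sup>2 - u\<^sup>2))"
proof (cases "\<bar>u\<bar> \<le> M")
  case True
  have "(\<integral>\<^sup>+t. ennreal (2 * t) * indicator {0..M} t * indicator {\<bar>u\<bar><..} t \<partial>lborel)
      = (\<integral>\<^sup>+t. ennreal (2 * t) * indicator {\<bar>u\<bar>..M} t \<partial>lborel)"
    by (rule nn_integral_cong_AE, rule AE_mp[OF AE_lborel_singleton[of "\<bar>u\<bar>"]])
       (auto simp: indicator_def)
  also have "\<dots> = ennreal (M\<^sup>2 - \<bar>u\<bar>\<^sup>2)"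
    by (rule nn_integral_FTC_Icc) (auto intro!: derivative_eq_intros simp: True)
  finally show ?thesis
    using True by (simp add: abs_le_square_iff[symmetric] max_def)
next
  case False
  have "(\<integral>\<^sup>+t. ennreal (2 * t) * indicator {0..M} t * indicator {\<bar>u\<bar><..} t \<partial>lborel) = (\<integral>\<^sup>+t. 0 \<partial>(lborel::real measure))"
    using False by (intro nn_integral_cong) (auto simp: indicator_def)
  moreover have "M\<^sup>2 \<le> u\<^sup>2"
    using False assms by (simp add: abs_le_square_iff[symmetric])
  ultimately show ?thesis by (simp add: max_def)
qed

lemma layer_cake_truncated_square:
  fixes h :: "'a \<Rightarrow> real"
  assumes "finite_measure N" and h[measurable]: "h \<in> borel_measurable N" and M: "0 \<le> M"
  shows "(\<integral>\<^sup>+x. ennreal (max 0 (M\<^sup>2 - (h x)\<^sup>2)) \<partial>N)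
       = (\<integral>\<^sup>+t. ennreal (2 * t * measure N {x \<in> space N. \<bar>h x\<bar> < t}) * indicator {0..M} t \<partial>lborel)"
proof -
  interpret N: finite_measure N by fact
  interpret P: pair_sigma_finite N "lborel :: real measure" ..
  have "(\<integral>\<^sup>+x. ennreal (max 0 (M\<^sup>2 - (h x)\<^sup>2)) \<partial>N)
     = (\<integral>\<^sup>+x. (\<integral>\<^sup>+t. ennreal (2 * t) * indicator {0..M} t * indicator {\<bar>h x\<bar><..} t \<partial>lborel) \<partial>N)"
    by (simp add: nn_integral_truncated_square[OF M])
  also have "\<dots> = (\<integral>\<^sup>+t. (\<integral>\<^sup>+x. ennreal (2 * t) * indicator {0..M} t * indicator {\<bar>h x\<bar><..} t \<partial>N) \<partial>lborel)"
  proof (rule P.Fubini'[symmetric])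
    show "(\<lambda>(x, t). ennreal (2 * t) * indicator {0..M} t * indicator {\<bar>h x\<bar><..} t)
       \<in> borel_measurable (N \<Otimes>\<^sub>M lborel)"
      unfolding indicator_def greaterThan_iff by measurable
  qed
  also have "\<dots> = (\<integral>\<^sup>+t. ennreal (2 * t * measure N {x \<in> space N. \<bar>h x\<bar> < t}) * indicator {0..M} t \<partial>lborel)"
  proof (rule nn_integral_cong)
    fix t :: real
    have "(\<integral>\<^sup>+x. ennreal (2 * t) * indicator {0..M} t * indicator {\<bar>h x\<bar><..} t \<partial>N)
        = ennreal (2 * t) * indicator {0..M} t * (\<integral>\<^sup>+x. indicator {x \<in> space N. \<bar>h x\<bar> < t} x \<partial>N)"
      by (subst nn_integral_cmult[symmetric]) (auto intro!: nn_integral_cong simp: indicator_def)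
    also have "(\<integral>\<^sup>+x. indicator {x \<in> space N. \<bar>h x\<bar> < t} x \<partial>N) = ennreal (measure N {x \<in> space N. \<bar>h x\<bar> < t})"
      by (simp add: N.emeasure_eq_measure)
    also have "ennreal (2 * t) * indicator {0..M} t * \<dots>
        = ennreal (2 * t * measure N {x \<in> space N. \<bar>h x\<bar> < t}) * indicator {0..M} t"
      by (auto simp: ennreal_mult split: split_indicator)
    finally show "(\<integral>\<^sup>+x. ennreal (2 * t) * indicator {0..M} t * indicator {\<bar>h x\<bar><..} t \<partial>N)
        = ennreal (2 * t * measure N {x \<in> space N. \<bar>h x\<bar> < t}) * indicator {0..M} t" .
  qed
  finally show ?thesis .
qed

lemma nn_integral_quadratic:
  fixes C M :: real
  assumes "0 \<le> C" "0 \<le> M"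
  shows "(\<integral>\<^sup>+t. ennreal (2 * t * (2 * C * t)) * indicator {0..M} t \<partial>lborel) = ennreal (4 * C * M ^ 3 / 3)"
proof -
  have "(\<integral>\<^sup>+t. ennreal (2 * t * (2 * C * t)) * indicator {0..M} t \<partial>lborel)
      = ennreal (4 * C * M ^ 3 / 3 - 4 * C * 0 ^ 3 / 3)"
    using assms
    by (intro nn_integral_FTC_Icc) (auto intro!: derivative_eq_intros simp: power2_eq_square)
  then show ?thesis by simp
qed

text \<open>
  Among densities bounded by \<open>C\<close> the second moment is smallest for the uniform one on \<open>[-M, M]\<close> with
  \<open>M = 1 / (2 C)\<close>.  The function \<open>M\<^sup>2 - u\<^sup>2\<close> is at most its positive part, and the layer-cake formula
  bounds the mean of the positive part by the value that it has for the uniform density.  Only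
  intervals around \<open>0\<close> occur, so a bound on their probabilities suffices.
\<close>
lemma second_moment_ge:
  fixes h :: "'a \<Rightarrow> real"
  assumes N: "finite_measure N" "measure N (space N) = 1"
    and h: "h \<in> borel_measurable N" and int: "integrable N (\<lambda>x. (h x)\<^sup>2)" and C: "0 < C"
    and density: "\<And>t. 0 < t \<Longrightarrow> measure N {x \<in> space N. \<bar>h x\<bar> < t} \<le> 2 * C * t"
  shows "1 / (12 * C\<^sup>2) \<le> (\<integral>x. (h x)\<^sup>2 \<partial>N)"
proof -
  interpret N: finite_measure N by fact
  define M where "M = 1 / (2 * C)"
  have M: "0 \<le> M" using C by (simp add: M_def)
  have int': "integrable N (\<lambda>x. max 0 (M\<^sup>2 - (h x)\<^sup>2))" using int by simp
  have "ennreal (\<integral>x. max 0 (M\<^sup>2 - (h x)\<^sup>2) \<partial>N) = (\<integral>\<^sup>+x. ennreal (max 0 (M\<^sup>2 - (h x)\<^sup>2)) \<partial>N)"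
    using int' by (intro nn_integral_eq_integral[symmetric]) auto
  also have "\<dots> \<le> (\<integral>\<^sup>+t. ennreal (2 * t * (2 * C * t)) * indicator {0..M} t \<partial>lborel)"
    unfolding layer_cake_truncated_square[OF N(1) h M]
  proof (intro nn_integral_mono mult_right_mono)
    fix t :: real
    show "ennreal (2 * t * measure N {x \<in> space N. \<bar>h x\<bar> < t}) \<le> ennreal (2 * t * (2 * C * t))"
    proof (cases "0 < t")
      case True
      then show ?thesis by (intro ennreal_leI mult_left_mono density) auto
    next
      case False
      then have "2 * t * measure N {x \<in> space N. \<bar>h x\<bar> < t} \<le> 0"
        by (simp add: mult_nonpos_nonneg)
      then have "ennreal (2 * t * measure N {x \<in> space N. \<bar>h x\<bar> < t}) = 0" by (rule ennreal_neg)
      then show ?thesis by (simp only: zero_le)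
    qed
  qed auto
  also have "\<dots> = ennreal (4 * C * M ^ 3 / 3)"
    using C M by (intro nn_integral_quadratic) auto
  finally have upper: "(\<integral>x. max 0 (M\<^sup>2 - (h x)\<^sup>2) \<partial>N) \<le> 4 * C * M ^ 3 / 3"
    using C M by simp
  have "M\<^sup>2 - (\<integral>x. (h x)\<^sup>2 \<partial>N) = (\<integral>x. M\<^sup>2 - (h x)\<^sup>2 \<partial>N)"
    using int N(2) by simp
  also have "\<dots> \<le> (\<integral>x. max 0 (M\<^sup>2 - (h x)\<^sup>2) \<partial>N)"
    using int int' by (intro integral_mono) auto
  finally have "M\<^sup>2 - 4 * C * M ^ 3 / 3 \<le> (\<integral>x. (h x)\<^sup>2 \<partial>N)"
    using upper by simp
  moreover have "M\<^sup>2 - 4 * C * M ^ 3 / 3 = 1 / (12 * C\<^sup>2)"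
    using C by (simp add: M_def power2_eq_square power3_eq_cube field_simps)
  ultimately show ?thesis by simp
qed

text \<open>
  The same computation, now with equality throughout: \<open>1/2\<close> bounds \<open>\<bar>h\<bar>\<close>, so nothing is truncated.
\<close>
lemma second_moment_uniform:
  fixes h :: "'a \<Rightarrow> real"
  assumes N: "finite_measure N" "measure N (space N) = 1"
    and h: "h \<in> borel_measurable N" and bound: "\<And>x. x \<in> space N \<Longrightarrow> \<bar>h x\<bar> \<le> 1/2"
    and uniform: "\<And>t. 0 \<le> t \<Longrightarrow> t \<le> 1/2 \<Longrightarrow> measure N {x \<in> space N. \<bar>h x\<bar> < t} = 2 * t"
  shows "(\<integral>x. (h x)\<^sup>2 \<partial>N) = 1 / 12"
proof -
  interpret N: finite_measure N by fact
  have sq: "(h x)\<^sup>2 \<le> (1/2)\<^sup>2" if "x \<in> space N" for x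
    using bound[OF that] by (simp add: abs_le_square_iff[symmetric])
  have int: "integrable N (\<lambda>x. (h x)\<^sup>2)"
    using h sq by (intro N.integrable_const_bound[of _ "(1/2)\<^sup>2"]) auto
  have "ennreal (1/4 - (\<integral>x. (h x)\<^sup>2 \<partial>N)) = ennreal (\<integral>x. (1/2)\<^sup>2 - (h x)\<^sup>2 \<partial>N)"
    using int N(2) by (simp add: power2_eq_square)
  also have "\<dots> = (\<integral>\<^sup>+x. ennreal ((1/2)\<^sup>2 - (h x)\<^sup>2) \<partial>N)"
    using int sq by (intro nn_integral_eq_integral[symmetric]) auto
  also have "\<dots> = (\<integral>\<^sup>+x. ennreal (max 0 ((1/2)\<^sup>2 - (h x)\<^sup>2)) \<partial>N)"
    using sq by (intro nn_integral_cong) (simp add: max_def)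
  also have "\<dots> = (\<integral>\<^sup>+t. ennreal (2 * t * (2 * 1 * t)) * indicator {0..1/2} t \<partial>lborel)"
    unfolding layer_cake_truncated_square[OF N(1) h, of "1/2", simplified]
    using uniform by (intro nn_integral_cong) (auto simp: indicator_def)
  also have "\<dots> = ennreal (1/6)"
    by (subst nn_integral_quadratic) (auto simp: power3_eq_cube)
  finally have "ennreal (1/4 - (\<integral>x. (h x)\<^sup>2 \<partial>N)) = ennreal (1/6)" .
  then have "1/4 - (\<integral>x. (h x)\<^sup>2 \<partial>N) = 1/6"
    by (metis ennreal_eq_0_iff ennreal_inj linear not_one_le_zero divide_pos_pos zero_less_one zero_less_numeral not_less)
  then show ?thesis by simp
qed

section \<open>Linear functionals on the cube\<close>

definition unit_cube :: "(real^'n) set" where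
  "unit_cube = {y. \<forall>i. \<bar>y $ i\<bar> < 1/2}"

lemma open_unit_cube: "open (unit_cube :: (real^'n) set)"
proof -
  have "unit_cube = (\<Inter>i. {y::real^'n. \<bar>y $ i\<bar> < 1/2})" by (auto simp: unit_cube_def)
  also have "open \<dots>"
    by (intro open_INT ballI open_Collect_less continuous_intros) auto
  finally show ?thesis .
qed

lemma emeasure_symmetric_box:
  fixes r :: "'n::finite \<Rightarrow> real"
  assumes "\<And>i. 0 \<le> r i"
  shows "emeasure lborel {y::real^'n. \<forall>i. \<bar>y $ i\<bar> < r i} = ennreal (\<Prod>i\<in>UNIV. 2 * r i)"
proof -
  define l u :: "real^'n" where "l = (\<chi> i. - r i)" and "u = (\<chi> i. r i)"
  have ne: "cbox l u \<noteq> {}"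
    using assms by (auto simp: interval_ne_empty_cart l_def u_def intro: order_trans[of _ 0])
  have "{y::real^'n. \<forall>i. \<bar>y $ i\<bar> < r i} = box l u"
    by (auto simp: mem_box_cart l_def u_def abs_less_iff) (metis minus_less_iff)+
  also have "emeasure lborel (box l u) = emeasure lborel (cbox l u)"
    using ne by (simp add: emeasure_lborel_box_eq emeasure_lborel_cbox_eq)
  also have "\<dots> = ennreal (measure lborel (cbox l u))"
    by (rule emeasure_eq_ennreal_measure) (use emeasure_lborel_cbox_finite[of l u] in auto)
  also have "measure lborel (cbox l u) = (\<Prod>i\<in>UNIV. 2 * r i)"
    unfolding content_cbox_cart[OF ne] by (simp add: l_def u_def)
  finally show ?thesis .
qed

text \<open>
  Used to see that distinct coordinates are uncorrelated on the cube.
\<close>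
lemma lborel_reflection:
  fixes i :: "'n::finite"
  shows "distr lborel borel (\<lambda>x::real^'n. x - (2 * x $ i) *\<^sub>R axis i 1) = lborel"
proof -
  define c :: "real^'n \<Rightarrow> real" where "c j = (if j = axis i 1 then -1 else 1)" for j
  have T: "(\<lambda>x. 0 + (\<Sum>j\<in>Basis. (c j * (x \<bullet> j)) *\<^sub>R j)) = (\<lambda>x::real^'n. x - (2 * x $ i) *\<^sub>R axis i 1)"
  proof
    fix x :: "real^'n"
    have "(\<Sum>j\<in>Basis. (c j * (x \<bullet> j)) *\<^sub>R j)
        = (\<Sum>j\<in>Basis. (x \<bullet> j) *\<^sub>R j - (if j = axis i 1 then (2 * (x \<bullet> j)) *\<^sub>R j else 0))"
      by (intro sum.cong) (auto simp: c_def simp flip: scaleR_left_distrib scaleR_left_diff_distrib)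
    also have "\<dots> = x - (2 * x $ i) *\<^sub>R axis i 1"
      by (simp add: sum_subtractf euclidean_representation inner_axis)
    finally show "0 + (\<Sum>j\<in>Basis. (c j * (x \<bullet> j)) *\<^sub>R j) = x - (2 * x $ i) *\<^sub>R axis i 1" by simp
  qed
  have "(\<Prod>j\<in>Basis. \<bar>c j\<bar>) = 1" by (intro prod.neutral) (auto simp: c_def)
  moreover have "lborel = density (distr lborel borel (\<lambda>x. 0 + (\<Sum>j\<in>Basis. (c j * (x \<bullet> j)) *\<^sub>R j))) (\<lambda>_. (\<Prod>j\<in>Basis. \<bar>c j\<bar>))"
    by (rule lborel_affine_euclidean) (simp add: c_def)
  ultimately show ?thesis unfolding T by (simp add: density_1)
qed

abbreviation cube_measure :: "(real^'n) measure" where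
  "cube_measure \<equiv> restrict_space lborel unit_cube"

lemma cube_measure_total:
  "finite_measure (cube_measure :: (real^'n) measure)"
  "measure (cube_measure :: (real^'n) measure) (space cube_measure) = 1"
proof -
  have "emeasure (cube_measure :: (real^'n) measure) (space cube_measure) = 1"
    using emeasure_symmetric_box[of "\<lambda>_::'n. 1/2"] open_unit_cube[where 'n='n]
    by (simp add: emeasure_restrict_space space_restrict_space unit_cube_def)
  then show "finite_measure (cube_measure :: (real^'n) measure)"
    "measure (cube_measure :: (real^'n) measure) (space cube_measure) = 1"
    by (auto intro!: finite_measureI simp: measure_def)
qed

lemma space_cube_measure: "space (cube_measure :: (real^'n) measure) = unit_cube"
  by (simp add: space_restrict_space)

lemma measure_cube_measure:
  assumes "{y. P y} \<in> sets borel"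
  shows "measure cube_measure {y \<in> space cube_measure. P y} = measure lborel {y \<in> unit_cube. P y}"
proof -
  have "{y \<in> unit_cube. P y} = unit_cube \<inter> {y. P y}" by auto
  then show ?thesis
    using borel_open[OF open_unit_cube] assms unfolding space_cube_measure
    by (subst measure_restrict_space) auto
qed

lemma borel_measurable_cube_measure:
  "f \<in> borel_measurable borel \<Longrightarrow> f \<in> borel_measurable (cube_measure :: (real^'n) measure)"
  by (rule measurable_restrict_space1) simp

lemma cube_integrable_product:
  "integrable (cube_measure :: (real^'n) measure) (\<lambda>y. y $ i * y $ j)"
proof -
  interpret finite_measure "cube_measure :: (real^'n) measure" by (rule cube_measure_total)
  have "\<bar>y $ i * y $ j\<bar> \<le> 1 / 2 * (1 / 2)" if "y \<in> unit_cube" for y :: "real^'n"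
    using that unfolding abs_mult unit_cube_def
    by (intro mult_mono) (auto simp: less_imp_le)
  then show ?thesis
    by (intro integrable_const_bound[of _ "1 / 2 * (1 / 2)"] borel_measurable_cube_measure)
       (auto simp: space_cube_measure)
qed

text \<open>
  The coordinates are centred, uncorrelated and uniform on an interval of length one.
\<close>
lemma cube_second_moments:
  "(\<integral>y. y $ i * y $ j \<partial>(cube_measure :: (real^'n) measure)) = (if i = j then 1 / 12 else 0)"
proof (cases "i = j")
  case True
  have "(\<integral>y. (y $ i)\<^sup>2 \<partial>(cube_measure :: (real^'n) measure)) = 1 / 12"
  proof (rule second_moment_uniform[OF cube_measure_total])
    show "(\<lambda>y. y $ i) \<in> borel_measurable (cube_measure :: (real^'n) measure)"
      by (intro borel_measurable_cube_measure) simp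
    show "\<bar>y $ i\<bar> \<le> 1 / 2" if "y \<in> space cube_measure" for y :: "real^'n"
      using that by (auto simp: space_cube_measure unit_cube_def less_imp_le)
    fix t :: real assume t: "0 \<le> t" "t \<le> 1/2"
    have eq: "{y \<in> unit_cube. \<bar>y $ i\<bar> < t} = {y::real^'n. \<forall>k. \<bar>y $ k\<bar> < (if k = i then t else 1/2)}"
    proof (intro set_eqI iffI)
      fix y :: "real^'n" assume y: "y \<in> {y. \<forall>k. \<bar>y $ k\<bar> < (if k = i then t else 1/2)}"
      then have "\<bar>y $ i\<bar> < t" "\<And>k. k \<noteq> i \<Longrightarrow> \<bar>y $ k\<bar> < 1/2"
        by (auto split: if_splits dest: spec[of _ i])
      with t have "\<bar>y $ k\<bar> < 1/2" for k by (cases "k = i") auto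
      with \<open>\<bar>y $ i\<bar> < t\<close> show "y \<in> {y \<in> unit_cube. \<bar>y $ i\<bar> < t}"
        by (simp add: unit_cube_def)
    qed (auto simp: unit_cube_def)
    have "measure lborel {y \<in> unit_cube. \<bar>y $ i\<bar> < t} = (\<Prod>k\<in>UNIV. 2 * (if k = i then t else 1/2))"
      unfolding eq measure_def using t by (subst emeasure_symmetric_box) (auto intro!: enn2real_ennreal prod_nonneg)
    also have "\<dots> = (\<Prod>k\<in>UNIV. if k = i then 2 * t else 1)"
      by (intro prod.cong) auto
    also have "\<dots> = 2 * t" by simp
    finally show "measure cube_measure {y \<in> space cube_measure. \<bar>y $ i\<bar> < t} = 2 * t"
      by (subst measure_cube_measure) auto
  qed
  with True show ?thesis by (simp add: power2_eq_square)
next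
  case False
  define \<phi> where "\<phi> = (\<lambda>x::real^'n. x - (2 * x $ i) *\<^sub>R axis i 1)"
  define g where "g = (\<lambda>y::real^'n. indicator unit_cube y *\<^sub>R (y $ i * y $ j))"
  have \<phi>_nth: "\<phi> y $ k = (if k = i then - (y $ k) else y $ k)" for y k
    by (simp add: \<phi>_def axis_def)
  have cube: "\<phi> y \<in> unit_cube \<longleftrightarrow> y \<in> unit_cube" for y
  proof -
    have "\<bar>\<phi> y $ k\<bar> = \<bar>y $ k\<bar>" for k by (simp add: \<phi>_nth)
    then show ?thesis by (simp add: unit_cube_def)
  qed
  have g_borel: "g \<in> borel_measurable borel"
    unfolding g_def using borel_open[OF open_unit_cube[where 'n='n]]
    by (intro borel_measurable_scaleR borel_measurable_indicator borel_measurable_times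
        borel_measurable_continuous_onI continuous_intros) auto
  have \<phi>_borel: "\<phi> \<in> borel_measurable borel"
    unfolding \<phi>_def by measurable
  have g_odd: "g (\<phi> y) = - g y" for y
    using False by (auto simp: g_def \<phi>_nth cube indicator_def)
  have "(\<integral>y. g y \<partial>lborel) = (\<integral>y. g y \<partial>distr lborel borel \<phi>)"
    unfolding \<phi>_def lborel_reflection ..
  also have "\<dots> = (\<integral>y. g (\<phi> y) \<partial>lborel)"
    using g_borel \<phi>_borel by (intro integral_distr) auto
  also have "\<dots> = - (\<integral>y. g y \<partial>lborel)" by (simp add: g_odd)
  finally have "(\<integral>y. g y \<partial>lborel) = 0" by simp
  moreover have "(\<integral>y. y $ i * y $ j \<partial>(cube_measure :: (real^'n) measure)) = (\<integral>y. g y \<partial>lborel)"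
    unfolding g_def using borel_open[OF open_unit_cube[where 'n='n]]
    by (intro integral_restrict_space) auto
  ultimately show ?thesis using False by simp
qed

text \<open>
  Comparing the exact second moment \<open>\<bar>b\<bar>\<^sup>2 / 12\<close> of \<open>b \<bullet> y\<close> with the lower bound \<open>1 / (12 C\<^sup>2)\<close>.  As \<open>t\<close>
  tends to \<open>0\<close> this is Hensley's bound for central hyperplane sections of the cube.
\<close>
lemma cube_slab_density_ge:
  fixes b :: "real^'n"
  assumes C: "0 < C"
    and slab: "\<And>t. 0 < t \<Longrightarrow> measure lborel {y \<in> unit_cube. \<bar>b \<bullet> y\<bar> < t} \<le> 2 * C * t"
  shows "1 \<le> C * norm b"
proof -
  have sq: "(b \<bullet> y)\<^sup>2 = (\<Sum>i\<in>UNIV. \<Sum>j\<in>UNIV. (b $ i * b $ j) * (y $ i * y $ j))" for y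
    unfolding power2_eq_square inner_vec_def inner_real_def sum_product
    by (intro sum.cong refl) (simp only: ac_simps)
  have int: "integrable (cube_measure :: (real^'n) measure) (\<lambda>y. (b \<bullet> y)\<^sup>2)"
    unfolding sq by (intro Bochner_Integration.integrable_sum integrable_mult_right cube_integrable_product)
  have "(\<integral>y. (b \<bullet> y)\<^sup>2 \<partial>(cube_measure :: (real^'n) measure))
      = (\<Sum>i\<in>UNIV. \<integral>y. (\<Sum>j\<in>UNIV. (b $ i * b $ j) * (y $ i * y $ j)) \<partial>(cube_measure :: (real^'n) measure))"
    unfolding sq
    by (rule Bochner_Integration.integral_sum)
       (intro Bochner_Integration.integrable_sum integrable_mult_right cube_integrable_product)
  also have "\<dots> = (\<Sum>i\<in>UNIV. \<Sum>j\<in>UNIV. \<integral>y. (b $ i * b $ j) * (y $ i * y $ j) \<partial>(cube_measure :: (real^'n) measure))"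
    by (rule sum.cong[OF refl], rule Bochner_Integration.integral_sum)
       (intro integrable_mult_right cube_integrable_product)
  also have "\<dots> = (\<Sum>i\<in>UNIV. \<Sum>j\<in>UNIV. (b $ i * b $ j) * (if i = j then 1/12 else 0))"
    by (simp only: Bochner_Integration.integral_mult_right_zero cube_second_moments)
  also have "\<dots> = (norm b)\<^sup>2 / 12"
    by (simp add: power2_norm_eq_inner inner_vec_def sum_divide_distrib if_distrib[of "\<lambda>u. _ * u"] cong: if_cong)
  finally have moment: "(\<integral>y. (b \<bullet> y)\<^sup>2 \<partial>(cube_measure :: (real^'n) measure)) = (norm b)\<^sup>2 / 12" .
  have "1 / (12 * C\<^sup>2) \<le> (\<integral>y. (b \<bullet> y)\<^sup>2 \<partial>(cube_measure :: (real^'n) measure))"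
  proof (rule second_moment_ge[OF cube_measure_total _ int C])
    show "(\<lambda>y. b \<bullet> y) \<in> borel_measurable (cube_measure :: (real^'n) measure)"
      by (intro borel_measurable_cube_measure) simp
    show "measure cube_measure {y \<in> space cube_measure. \<bar>b \<bullet> y\<bar> < t} \<le> 2 * C * t" if "0 < t" for t
      using slab[OF that] by (subst measure_cube_measure) auto
  qed
  then have "12 * C\<^sup>2 * (1 / (12 * C\<^sup>2)) \<le> 12 * C\<^sup>2 * ((norm b)\<^sup>2 / 12)"
    unfolding moment by (rule mult_left_mono) simp
  then have "1\<^sup>2 \<le> (C * norm b)\<^sup>2"
    using C by (simp add: power_mult_distrib)
  then show ?thesis using C by (intro power2_le_imp_le[of 1]) auto
qed

section \<open>The transference inequality\<close>

definition open_parallelepiped :: "real^'n^'n \<Rightarrow> real^'n \<Rightarrow> (real^'n) set" where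
  "open_parallelepiped H \<eta> = {z. \<forall>i. \<bar>row i H \<bullet> z\<bar> < \<eta> $ i}"

lemma open_parallelepiped_subset: "open_parallelepiped H \<eta> \<subseteq> parallelepiped_of_forms H \<eta>"
  by (auto simp: open_parallelepiped_def parallelepiped_of_forms_def less_imp_le)

lemma open_open_parallelepiped: "open (open_parallelepiped H \<eta>)"
proof -
  have "open_parallelepiped H \<eta> = (\<Inter>i. {z. \<bar>row i H \<bullet> z\<bar> < \<eta> $ i})"
    by (auto simp: open_parallelepiped_def)
  also have "open \<dots>"
    by (intro open_INT ballI open_Collect_less continuous_intros) auto
  finally show ?thesis .
qed

lemma convex_open_parallelepiped: "convex (open_parallelepiped H \<eta>)"
proof -
  have "open_parallelepiped H \<eta> = (\<Inter>i. {z. row i H \<bullet> z < \<eta> $ i} \<inter> {z. row i H \<bullet> z > - \<eta> $ i})"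
    by (auto simp: open_parallelepiped_def abs_less_iff minus_less_iff)
  then show ?thesis
    by (auto intro!: convex_INT convex_Int convex_halfspace_lt convex_halfspace_gt)
qed

lemma dual_forms_inverse:
  assumes "dual_forms H H'"
  shows "H ** transpose H' = mat 1" "transpose H' ** H = mat 1"
proof -
  show "H ** transpose H' = mat 1"
    using assms
    by (simp add: dual_forms_def vec_eq_iff matrix_matrix_mult_def transpose_def mat_def row_def inner_vec_def)
  then show "transpose H' ** H = mat 1" by (simp add: matrix_left_right_inverse)
qed

lemma matrix_vector_mult_nth: "(A *v x) $ i = row i A \<bullet> x" for A :: "real^'n^'m"
  by (simp add: matrix_vector_mult_def row_def inner_vec_def)

text \<open>
  The linear map \<open>\<phi>\<close> sends the cube to \<open>K / 2\<close>, multiplies volumes by \<open>V\<close>, and pulls \<open>v\<close> back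
  to \<open>V b\<close>; hence the slab estimate for \<open>K\<close> at width \<open>V t\<close> is a slab estimate for the cube at width \<open>t\<close>
  in which \<open>V\<close> cancels.
\<close>
lemma transference_inequality:
  fixes H H' :: "real^'n^'n" and \<eta> v :: "real^'n"
  assumes \<eta>: "\<And>i. 0 < \<eta> $ i" and H: "det H = 1" and dual: "dual_forms H H'"
    and v: "v \<in> integer_lattice" "v \<noteq> 0"
    and v_bound: "\<And>i. \<bar>row i H' \<bullet> v\<bar> \<le> \<mu> * (1 / \<eta> $ i * (\<Prod>j\<in>UNIV. \<eta> $ j))" and \<mu>: "0 \<le> \<mu>"
    and lam: "1 \<le> lam"
    and adm: "\<And>z. z \<in> open_parallelepiped H \<eta> \<Longrightarrow> z \<in> integer_lattice \<Longrightarrow> z = 0"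
    and dimL: "dim {z \<in> integer_lattice. v \<bullet> z = 0 \<and> z /\<^sub>R lam \<in> open_parallelepiped H \<eta>} \<le> m"
  shows "lam ^ (CARD('n) - 1 - m) \<le> \<mu> * sqrt CARD('n)"
proof -
  define V where "V = (\<Prod>j\<in>UNIV. \<eta> $ j)"
  have V: "0 < V" using \<eta> by (simp add: V_def prod_pos)
  define K where "K = open_parallelepiped H \<eta>"
  define \<phi> where "\<phi> y = transpose H' *v (\<chi> i. \<eta> $ i * y $ i)" for y :: "real^'n"
  define b :: "real^'n" where "b = (\<chi> i. (row i H' \<bullet> v) * \<eta> $ i / V)"
  note inv = dual_forms_inverse[OF dual]
  have lin: "linear \<phi>"
  proof -
    have "linear (\<lambda>y::real^'n. (\<chi> i. \<eta> $ i * y $ i))"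
      by (rule linearI) (simp_all add: vec_eq_iff algebra_simps)
    moreover have "\<phi> = (\<lambda>y. transpose H' *v y) \<circ> (\<lambda>y. \<chi> i. \<eta> $ i * y $ i)"
      by (simp only: fun_eq_iff \<phi>_def o_apply simp_thms)
    ultimately show ?thesis
      by (simp only: linear_compose matrix_vector_mul_linear)
  qed
  have form_\<phi>: "row i H \<bullet> \<phi> y = \<eta> $ i * y $ i" for i y
  proof -
    have "H *v \<phi> y = (H ** transpose H') *v (\<chi> i. \<eta> $ i * y $ i)"
      by (simp only: \<phi>_def matrix_vector_mul_assoc)
    then show ?thesis by (simp add: inv matrix_vector_mult_nth[symmetric])
  qed
  have \<phi>_surj: "\<phi> (\<chi> i. (row i H \<bullet> x) / \<eta> $ i) = x" for x
  proof -
    have "(\<chi> i. \<eta> $ i * ((row i H \<bullet> x) / \<eta> $ i)) = H *v x"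
      using less_imp_neq[OF \<eta>] by (simp add: vec_eq_iff matrix_vector_mult_nth)
    then show ?thesis by (simp add: \<phi>_def matrix_vector_mul_assoc inv)
  qed
  have v_\<phi>: "v \<bullet> \<phi> y = V * (b \<bullet> y)" for y
  proof -
    have "v \<bullet> \<phi> y = ((\<chi> i. \<eta> $ i * y $ i) v* H') \<bullet> v"
      by (simp only: \<phi>_def transpose_matrix_vector inner_commute)
    also have "\<dots> = (\<chi> i. \<eta> $ i * y $ i) \<bullet> (H' *v v)"
      by (rule dot_lmul_matrix)
    also have "\<dots> = V * (b \<bullet> y)"
      unfolding inner_vec_def[of b y] inner_vec_def[of _ "H' *v v"]
      using V by (simp add: matrix_vector_mult_nth b_def sum_distrib_left)
         (intro sum.cong refl; simp only: ac_simps)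
    finally show ?thesis .
  qed
  have det_\<phi>: "\<bar>det (matrix \<phi>)\<bar> = V"
  proof -
    have "matrix \<phi> = transpose H' ** (\<chi> i j. if i = j then \<eta> $ i else 0)"
    proof -
      have "\<phi> y = (transpose H' ** (\<chi> i j. if i = j then \<eta> $ i else 0)) *v y" for y
      proof -
        have "(\<chi> i j. if i = j then \<eta> $ i else 0) *v y = (\<chi> i. \<eta> $ i * y $ i)"
          by (simp add: vec_eq_iff matrix_vector_mult_def if_distrib[of "\<lambda>u. u * _"] cong: if_cong)
        then show ?thesis by (simp add: \<phi>_def flip: matrix_vector_mul_assoc del: transpose_matrix_vector)
      qed
      then have "\<phi> = (*v) (transpose H' ** (\<chi> i j. if i = j then \<eta> $ i else 0))" by (rule ext)
      then show ?thesis by (simp only: matrix_of_matrix_vector_mul)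
    qed
    then have "det (matrix \<phi>) = det H' * V"
      by (simp add: det_mul det_diagonal V_def)
    moreover have "det H' = 1"
      using det_mul[of H "transpose H'"] H by (simp add: inv)
    ultimately show ?thesis using V by simp
  qed
  have half: "\<phi> y \<in> {x. 2 *\<^sub>R x \<in> K} \<longleftrightarrow> y \<in> unit_cube" for y
  proof -
    have "2 * (\<eta> $ i * \<bar>y $ i\<bar>) < \<eta> $ i \<longleftrightarrow> \<bar>y $ i\<bar> < 1/2" for i
      using \<eta>[of i] by (simp add: mult.left_commute) linarith
    then show ?thesis
      using \<eta> by (simp add: K_def open_parallelepiped_def unit_cube_def form_\<phi> abs_mult less_imp_le)
  qed
  have half_eq: "{x. 2 *\<^sub>R x \<in> K} = \<phi> ` unit_cube"
  proof (intro set_eqI iffI)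
    fix x assume x: "x \<in> {x. 2 *\<^sub>R x \<in> K}"
    then have "(\<chi> i. (row i H \<bullet> x) / \<eta> $ i) \<in> unit_cube"
      using half[of "\<chi> i. (row i H \<bullet> x) / \<eta> $ i"] unfolding \<phi>_surj by blast
    then show "x \<in> \<phi> ` unit_cube"
      by (rule rev_image_eqI) (simp only: \<phi>_surj)
  qed (use half in blast)
  have cube_bounded: "bounded (unit_cube :: (real^'n) set)"
  proof (rule bounded_subset[OF bounded_cbox])
    have "- 1 \<le> r \<and> r \<le> 1" if "\<bar>r\<bar> < 1/2" for r :: real using that by linarith
    then show "(unit_cube :: (real^'n) set) \<subseteq> cbox (\<chi> i. -1) (\<chi> i. 1)"
      by (auto simp: unit_cube_def mem_box_cart)
  qed
  have "bounded K"
  proof -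
    have "K \<subseteq> (\<lambda>x. 2 *\<^sub>R x) ` {x. 2 *\<^sub>R x \<in> K}"
    proof
      fix x assume "x \<in> K"
      then show "x \<in> (\<lambda>x. 2 *\<^sub>R x) ` {x. 2 *\<^sub>R x \<in> K}"
        by (intro image_eqI[of _ _ "(1/2) *\<^sub>R x"]) auto
    qed
    moreover have "bounded (\<phi> ` unit_cube)"
      using cube_bounded lin by (intro bounded_linear_image linear_conv_bounded_linear[THEN iffD1])
    ultimately show ?thesis
      unfolding half_eq by (rule bounded_subset[OF bounded_scaling, rotated])
  qed
  have slab: "measure lborel {y \<in> unit_cube. \<bar>b \<bullet> y\<bar> < t} \<le> 2 * (1 / lam ^ (CARD('n) - 1 - m)) * t"
    if t: "0 < t" for t
  proof -
    let ?S = "{y \<in> unit_cube. \<bar>b \<bullet> y\<bar> < t}"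
    have S: "open ?S" "bounded ?S"
    proof -
      have "?S = unit_cube \<inter> {y. \<bar>b \<bullet> y\<bar> < t}" by auto
      then show "open ?S"
        by (auto intro!: open_Int open_unit_cube open_Collect_less continuous_intros)
      show "bounded ?S" by (rule bounded_subset[OF cube_bounded]) auto
    qed
    have image: "\<phi> ` ?S = {x. 2 *\<^sub>R x \<in> K \<and> \<bar>v \<bullet> x\<bar> < V * t}"
    proof -
      have "\<bar>v \<bullet> \<phi> y\<bar> < V * t \<longleftrightarrow> \<bar>b \<bullet> y\<bar> < t" for y
        using V by (simp add: v_\<phi> abs_mult)
      then have "\<phi> ` ?S = \<phi> ` unit_cube \<inter> {x. \<bar>v \<bullet> x\<bar> < V * t}" by auto
      then show ?thesis by (auto simp flip: half_eq)
    qed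
    have "V * measure lebesgue ?S = measure lebesgue (\<phi> ` ?S)"
      using lmeasurable_linear_image_det[OF lin lmeasurable_open[OF S(2,1)]] det_\<phi> by simp
    also have "\<dots> \<le> 2 * (V * t) / lam ^ (CARD('n) - 1 - m)"
      unfolding image
    proof (rule slab_measure_le)
      show "open K" "convex K" "bounded K"
        using open_open_parallelepiped convex_open_parallelepiped \<open>bounded K\<close> by (auto simp: K_def)
      show "- x \<in> K" if "x \<in> K" for x
        using that by (simp add: K_def open_parallelepiped_def)
    qed (use v lam adm dimL V t in \<open>auto simp: K_def\<close>)
    finally have "V * measure lebesgue ?S \<le> V * (2 * (1 / lam ^ (CARD('n) - 1 - m)) * t)"
      by (simp add: ac_simps)
    then have "measure lebesgue ?S \<le> 2 * (1 / lam ^ (CARD('n) - 1 - m)) * t"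
      using V by (simp only: mult_le_cancel_left_pos)
    then show ?thesis using S(1) by simp
  qed
  have "1 \<le> 1 / lam ^ (CARD('n) - 1 - m) * norm b"
    using lam slab by (intro cube_slab_density_ge) auto
  then have "lam ^ (CARD('n) - 1 - m) \<le> norm b"
    using lam by (simp add: pos_le_divide_eq)
  also have "norm b \<le> sqrt (\<Sum>i\<in>(UNIV::'n set). \<mu>\<^sup>2)"
    unfolding norm_vec_def L2_set_def
  proof (intro real_sqrt_le_mono sum_mono)
    fix i
    have "\<bar>row i H' \<bullet> v\<bar> * (\<eta> $ i / V) \<le> \<mu> * (1 / \<eta> $ i * V) * (\<eta> $ i / V)"
      using v_bound[of i] V \<eta>[of i] by (intro mult_right_mono) (auto simp: V_def)
    also have "\<dots> = \<mu>" using V less_imp_neq[OF \<eta>[of i]] by simp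
    finally have "\<bar>b $ i\<bar> \<le> \<mu>"
      using V \<eta>[of i] by (simp add: b_def abs_mult)
    then show "(norm (b $ i))\<^sup>2 \<le> \<mu>\<^sup>2" by (simp add: abs_le_square_iff[symmetric])
  qed
  also have "\<dots> = \<mu> * sqrt CARD('n)"
    using \<mu> by (simp add: real_sqrt_mult)
  finally show ?thesis .
qed

section \<open>Successive minima\<close>

lemma successive_minimum_le:
  assumes "0 < \<mu>" "S \<subseteq> L \<inter> (\<lambda>x. \<mu> *\<^sub>R x) ` M" "independent S" "card S = k"
  shows "successive_minimum k M L \<le> \<mu>"
  unfolding successive_minimum_def
proof (rule cInf_lower)
  show "bdd_below {\<mu>. \<mu> > 0 \<and> (\<exists>S. S \<subseteq> L \<inter> (\<lambda>x. \<mu> *\<^sub>R x) ` M \<and> independent S \<and> card S = k)}"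
    by (rule bdd_belowI[of _ 0]) auto
qed (use assms in blast)

lemma scaled_mem_parallelepiped:
  assumes "0 < s"
  shows "z /\<^sub>R s \<in> parallelepiped_of_forms H \<eta> \<longleftrightarrow> (\<forall>i. \<bar>row i H \<bullet> z\<bar> \<le> s * \<eta> $ i)"
proof -
  have "\<bar>row i H \<bullet> (z /\<^sub>R s)\<bar> = \<bar>row i H \<bullet> z\<bar> / s" for i
    using assms by (simp add: abs_mult divide_inverse mult.commute)
  then show ?thesis
    using assms by (simp add: parallelepiped_of_forms_def pos_divide_le_eq mult.commute)
qed

text \<open>
  A point strictly inside the parallelepiped also lies in a dilate by some factor below \<open>1\<close>.
\<close>
lemma first_minimum_ge_1_imp_admissible:
  assumes \<eta>: "\<And>i. 0 < \<eta> $ i"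
    and min: "1 \<le> successive_minimum 1 (parallelepiped_of_forms H \<eta>) integer_lattice"
    and z: "z \<in> open_parallelepiped H \<eta>" "z \<in> integer_lattice"
  shows "z = 0"
proof (rule ccontr)
  assume "z \<noteq> 0"
  \<comment> \<open>The value \<open>1/2\<close> keeps the scaling factor positive; any number strictly between \<open>0\<close> and \<open>1\<close> would do.\<close>
  define R where "R = insert (1/2) (range (\<lambda>i. \<bar>row i H \<bullet> z\<bar> / \<eta> $ i))"
  define s where "s = Max R"
  have fin: "finite R" by (simp add: R_def)
  have "r < 1" if "r \<in> R" for r
    using that z(1) \<eta> by (auto simp: R_def open_parallelepiped_def)
  then have s1: "s < 1" using Max_in[OF fin] by (simp add: s_def R_def)
  have "1/2 \<le> s" unfolding s_def by (rule Max_ge[OF fin]) (simp add: R_def)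
  then have s0: "0 < s" by simp
  have "\<bar>row i H \<bullet> z\<bar> \<le> s * \<eta> $ i" for i
  proof -
    have "\<bar>row i H \<bullet> z\<bar> / \<eta> $ i \<le> s" unfolding s_def by (rule Max_ge[OF fin]) (simp add: R_def)
    then show ?thesis using \<eta>[of i] by (simp add: pos_divide_le_eq)
  qed
  then have "z /\<^sub>R s \<in> parallelepiped_of_forms H \<eta>"
    using s0 by (simp add: scaled_mem_parallelepiped)
  moreover have "z = s *\<^sub>R (z /\<^sub>R s)" using s0 by simp
  ultimately have "z \<in> (\<lambda>x. s *\<^sub>R x) ` parallelepiped_of_forms H \<eta>" by blast
  with s0 z(2) \<open>z \<noteq> 0\<close> have "successive_minimum 1 (parallelepiped_of_forms H \<eta>) integer_lattice \<le> s"
    by (intro successive_minimum_le[of _ "{z}"]) auto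
  with s1 min show False by simp
qed

text \<open>
  The bound \<open>w\<close> is strict, so that any dilation factor below it will do and the infimum need not be
  shown to be attained.  The infimum is over a non-empty set, because the all-ones vector lies in a
  large enough dilate.
\<close>
lemma first_minimum_less_imp_lattice_point:
  fixes H :: "real^'n^'n"
  assumes \<eta>: "\<And>i. 0 < \<eta> $ i"
    and min: "successive_minimum 1 (parallelepiped_of_forms H \<eta>) integer_lattice < w"
  obtains v \<mu> where "v \<in> integer_lattice" "v \<noteq> 0" "0 < \<mu>" "\<mu> < w"
    "\<And>i. \<bar>row i H \<bullet> v\<bar> \<le> \<mu> * \<eta> $ i"
proof -
  let ?X = "{\<mu>. \<mu> > 0 \<and> (\<exists>S. S \<subseteq> integer_lattice \<inter> (\<lambda>x. \<mu> *\<^sub>R x) ` parallelepiped_of_forms H \<eta>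
                 \<and> independent S \<and> card S = 1)}"
  have "?X \<noteq> {}"
  proof -
    define e :: "real^'n" where "e = (\<chi> i. 1)"
    have e: "e \<in> integer_lattice" "e \<noteq> 0"
      by (auto simp: e_def integer_lattice_def vec_eq_iff)
    define \<mu> where "\<mu> = 1 + (\<Sum>i\<in>UNIV. \<bar>row i H \<bullet> e\<bar> / \<eta> $ i)"
    have ratio: "0 \<le> \<bar>row i H \<bullet> e\<bar> / \<eta> $ i" for i
      using \<eta>[of i] by simp
    then have \<mu>: "0 < \<mu>" unfolding \<mu>_def by (intro add_pos_nonneg sum_nonneg) auto
    have "\<bar>row i H \<bullet> e\<bar> \<le> \<mu> * \<eta> $ i" for i
    proof -
      have "\<bar>row i H \<bullet> e\<bar> / \<eta> $ i \<le> (\<Sum>i\<in>UNIV. \<bar>row i H \<bullet> e\<bar> / \<eta> $ i)"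
        using ratio by (intro member_le_sum) auto
      then have "\<bar>row i H \<bullet> e\<bar> / \<eta> $ i \<le> \<mu>" by (simp add: \<mu>_def)
      then show ?thesis using \<eta>[of i] by (simp add: pos_divide_le_eq)
    qed
    then have "e /\<^sub>R \<mu> \<in> parallelepiped_of_forms H \<eta>"
      using \<mu> by (simp add: scaled_mem_parallelepiped)
    moreover have "e = \<mu> *\<^sub>R (e /\<^sub>R \<mu>)" using \<mu> by simp
    ultimately have "e \<in> (\<lambda>x. \<mu> *\<^sub>R x) ` parallelepiped_of_forms H \<eta>" by blast
    with \<mu> e have "\<mu> \<in> ?X" by (auto intro!: exI[of _ "{e}"])
    then show ?thesis by blast
  qed
  from cInf_lessD[OF this min[unfolded successive_minimum_def]]
  obtain \<mu> S where \<mu>: "0 < \<mu>" "\<mu> < w"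
    and S: "S \<subseteq> integer_lattice \<inter> (\<lambda>x. \<mu> *\<^sub>R x) ` parallelepiped_of_forms H \<eta>"
    "independent S" "card S = 1" by blast
  from S(3) obtain v where "S = {v}" by (rule card_1_singletonE)
  with S obtain x where "v \<in> integer_lattice" "v \<noteq> 0" "v = \<mu> *\<^sub>R x" "x \<in> parallelepiped_of_forms H \<eta>"
    by auto
  with \<mu> show thesis
    by (intro that[of v \<mu>]) (auto simp: parallelepiped_of_forms_def abs_mult)
qed

lemma dim_lattice_points_less:
  assumes lam: "0 < lam" and less: "lam < successive_minimum k M L"
    and A: "A \<subseteq> L" "\<And>z. z \<in> A \<Longrightarrow> z /\<^sub>R lam \<in> M"
  shows "dim A < k"
proof (rule ccontr)
  assume "\<not> dim A < k"
  moreover obtain B where B: "B \<subseteq> A" "independent B" "card B = dim A"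
    by (rule basis_exists[of A]) auto
  ultimately obtain S where S: "S \<subseteq> B" "card S = k"
    by (metis not_less obtain_subset_with_card_n)
  have "z \<in> (\<lambda>x. lam *\<^sub>R x) ` M" if "z \<in> A" for z
    using A(2)[OF that] lam by (intro image_eqI[of _ _ "z /\<^sub>R lam"]) auto
  then have "S \<subseteq> L \<inter> (\<lambda>x. lam *\<^sub>R x) ` M" using A(1) B(1) S(1) by blast
  then have "successive_minimum k M L \<le> lam"
    using lam S independent_mono[OF B(2)] by (intro successive_minimum_le) auto
  with less show False by simp
qed

theorem theorem1:
  fixes P P' :: "(real ^ 'n) set" and k :: nat
  assumes "CARD('n) \<ge> 2"
    and "symmetric_parallelepiped P"
    and "is_pseudo_compound P P'"
    and "successive_minimum 1 P' integer_lattice \<le> 1"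
    and "successive_minimum 1 P integer_lattice \<ge> 1"
    and "1 \<le> k" and "k \<le> CARD('n) - 1"
  shows "successive_minimum k P integer_lattice
           \<le> real CARD('n) powr (1 / (2 * (real CARD('n) - real k)))"
proof (rule ccontr)
  define d where "d = CARD('n)"
  define e where "e = d - k"
  have e: "0 < e" "real e = real d - real k" "d - 1 - (k - 1) = e"
    using assms(1,6,7) by (auto simp: e_def d_def)
  define R where "R = real d powr (1 / (2 * (real d - real k)))"
  assume "\<not> ?thesis"
  then have "R < successive_minimum k P integer_lattice" by (simp add: R_def d_def)
  then obtain lam where lam: "R < lam" "lam < successive_minimum k P integer_lattice"
    using dense by blast
  have "1 \<le> R"
    unfolding R_def using assms(1) e by (intro ge_one_powr_ge_zero) (auto simp: d_def)
  then have lam1: "1 \<le> lam" using lam(1) by simp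
  have "R ^ e = sqrt d"
  proof -
    have "R ^ e = real d powr (1 / (2 * real e) * real e)"
      unfolding R_def e(2)[symmetric] powr_powr[symmetric] using assms(1)
      by (intro powr_realpow[symmetric]) (simp add: d_def)
    also have "1 / (2 * real e) * real e = 1/2" using e(1) by simp
    finally show ?thesis by (simp add: powr_half_sqrt)
  qed
  moreover have "R ^ e < lam ^ e"
    using lam(1) \<open>1 \<le> R\<close> e(1) by (intro power_strict_mono) auto
  ultimately have gt: "sqrt d < lam ^ e" by simp
  have sqrt_d: "0 < sqrt d" using assms(1) by (simp add: d_def)
  obtain H H' \<eta> where \<eta>: "\<And>i. 0 < \<eta> $ i" and H: "det H = 1" "dual_forms H H'"
    and P: "P = parallelepiped_of_forms H \<eta>"
    and P': "P' = parallelepiped_of_forms H' (\<chi> i. 1 / \<eta> $ i * (\<Prod>j\<in>UNIV. \<eta> $ j))"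
    using assms(3) unfolding is_pseudo_compound_def by blast
  have \<eta>': "0 < (\<chi> i. 1 / \<eta> $ i * (\<Prod>j\<in>UNIV. \<eta> $ j)) $ i" for i
    using \<eta> by (simp add: prod_pos)
  \<comment> \<open>The factor \<open>\<mu>\<close> is allowed to exceed \<open>1\<close> by exactly the slack in \<open>sqrt d < lam ^ e\<close>.\<close>
  have "successive_minimum 1 P' integer_lattice < lam ^ e / sqrt d"
    using assms(4) gt sqrt_d by (simp add: pos_less_divide_eq order_le_less_trans[of _ 1])
  then obtain v \<mu> where v: "v \<in> integer_lattice" "v \<noteq> 0" and \<mu>: "0 < \<mu>" "\<mu> < lam ^ e / sqrt d"
    and v_bound': "\<And>i. \<bar>row i H' \<bullet> v\<bar> \<le> \<mu> * (\<chi> i. 1 / \<eta> $ i * (\<Prod>j\<in>UNIV. \<eta> $ j)) $ i"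
    unfolding P' using first_minimum_less_imp_lattice_point[OF \<eta>'] by blast
  have v_bound: "\<bar>row i H' \<bullet> v\<bar> \<le> \<mu> * (1 / \<eta> $ i * (\<Prod>j\<in>UNIV. \<eta> $ j))" for i
    using v_bound'[of i] by (simp only: vec_lambda_beta)
  have adm: "z = 0" if "z \<in> open_parallelepiped H \<eta>" "z \<in> integer_lattice" for z
    using first_minimum_ge_1_imp_admissible[OF \<eta> _ that] assms(5) by (simp add: P)
  have "dim {z \<in> integer_lattice. v \<bullet> z = 0 \<and> z /\<^sub>R lam \<in> open_parallelepiped H \<eta>} < k"
    using lam1 open_parallelepiped_subset by (intro dim_lattice_points_less[OF _ lam(2)]) (auto simp: P)
  then have "lam ^ (CARD('n) - 1 - (k - 1)) \<le> \<mu> * sqrt CARD('n)"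
    using \<mu>(1) by (intro transference_inequality[OF \<eta> H v v_bound _ lam1 adm]) auto
  also have "\<dots> < lam ^ e"
    using \<mu>(2) sqrt_d by (simp add: pos_less_divide_eq d_def)
  finally show False using e(3) by (simp add: d_def)
qed

end
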